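(* Let $p\in (0,1]$, $q\in (1,\infty)$, and $w\in A_\infty(X)$. (i) Every $F\in T_{2,w}^p(X)$ can be written as $F=\sum_{j=0}^\infty \lambda_j \mathfrak{a}_j$ almost everywhere, where the $\mathfrak{a}_j$ are $q$-atoms of $T_{2,w}^p(X)$, $\lambda_j\in \mathbb{C}$, and $$\Big( \sum_j |\lambda_j|^p\Big)^{1/p}\leq C \|F\|_{T_{2,w}^p(X)},$$ where $C$ is a positive constant independent of $F$. (ii) Conversely, if $\{\lambda_j\}_{j=0}^\infty \in \ell^p$ and the $\mathfrak{a}_j$ are $q$-atoms of $T_{2,w}^p(X)$, then $F=\sum_{j=0}^\infty \lambda_j \mathfrak{a}_j$ (sum taken pointwise almost everywhere) belongs to $T_{2,w}^p(X)$, and $$\|F\|_{T_{2,w}^p(X)}\leq \Big(\sum_{j}|\lambda_j|^p\Big)^{1/p }.$$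
   Context: $(X,d,\mu)$ is a metric measure space with distance $d$ and a nonnegative Borel measure $\mu$ that is doubling: with $B(x,r)=\{y\in X: d(x,y)<r\}$ and $V(x,r)=\mu(B(x,r))$, there is $C>0$ such that $V(x,2r)\le C V(x,r)<\infty$ for all $x\in X$, $r>0$. It is also assumed that $\mu(X)=\infty$ and $\mu(\{x\})=0$ for all $x\in X$. Weights: a weight $w$ is a nonnegative locally integrable function on $X$ with values in $(0,\infty)$ almost everywhere. For $1<r<\infty$, $w\in A_r(X)$ if $$\sup_B \Big( \frac{1}{\mu(B)}\int_B w\,d\mu\Big) \Big(\frac{1}{\mu(B)}\int_B w^{-1/(r-1)}\,d\mu\Big)^{r-1}<\infty,$$ the supremum being over all balls $B\subseteq X$. $A_\infty(X)$ is the union of the classes $A_r(X)$, $1<r<\infty$. For a measurable set $E$, $w(E)=\int_E w\,d\mu$. For $0<r<\infty$, $\|f\|_{L^r_w(X)}=(\int_X |f|^r w\,d\mu)^{1/r}$. Tent spaces: for $x\in X$ let $\Gamma(x)=\{(y,t)\in X\times(0,+\infty): d(x,y)<t\}$. For a measurable function $F$ on $X\times (0,+\infty)$, $$\mathcal{A}(F)(x)=\left(\iint_{\Gamma(x)} |F(y,t)|^2 \,\frac{d\mu(y)}{V(x,t)}\frac{dt}{t}\right)^{1/2}.$$ For $0<r<\infty$, $T_{2,w}^r(X)$ is the set of measurable $F$ on $X\times(0,+\infty)$ with $\mathcal{A}(F)\in L^r_w(X)$, and $\|F\|_{T_{2,w}^r(X)}=\|\mathcal{A}(F)\|_{L^r_w(X)}$.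 Atoms: for a ball $B\subseteq X$ let $T(B)=\{(x,t)\in X\times(0,+\infty): d(x,X\setminus B)\ge t\}$. A measurable function $\mathfrak{a}$ on $X\times(0,+\infty)$ is a $q$-atom of $T^p_{2,w}(X)$ if there is a ball $B\subseteq X$ such that $\mathrm{supp}\,\mathfrak{a}\subseteq T(B)$ and $\|\mathfrak{a}\|_{T^q_{2,w}(X)}\le w(B)^{1/q-1/p}$. *)

theory Defs
  imports "HOL-Analysis.Analysis"
begin

text \<open>Powers on $[0,\infty]$ with nonzero real exponent \<open>s\<close>; for \<open>s < 0\<close> the conventions are
  $0^s = \infty$ and $\infty^s = 0$.\<close>

definition epowr :: "ennreal \<Rightarrow> real \<Rightarrow> ennreal" where
  "epowr a s =
     (if a = \<infinity> then (if s < 0 then 0 else \<infinity>)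
      else if a = 0 \<and> s < 0 then \<infinity>
      else ennreal (enn2real a powr s))"

definition vol :: "'a::metric_space measure \<Rightarrow> 'a \<Rightarrow> real \<Rightarrow> ennreal" where
  "vol M x r = emeasure M (ball x r)"

definition doubling_measure :: "'a::metric_space measure \<Rightarrow> bool" where
  "doubling_measure M \<longleftrightarrow>
     sets M = sets borel \<and>
     (\<exists>C::real. C > 0 \<and>
        (\<forall>x r. r > 0 \<longrightarrow> vol M x (2 * r) \<le> ennreal C * vol M x r \<and> vol M x r < \<infinity>))"

text \<open>Local integrability is integrability on every ball. For weights in a Muckenhoupt class this
  does not depend on the reading of ``locally'', since the \<open>A\<^sub>r\<close> condition already forces
  integrability on balls.\<close>

definition weight :: "'a::metric_space measure \<Rightarrow> ('a \<Rightarrow> real) \<Rightarrow> bool" where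
  "weight M w \<longleftrightarrow>
     w \<in> borel_measurable M \<and> (\<forall>x. 0 \<le> w x) \<and>
     (\<forall>x r. set_integrable M (ball x r) w) \<and> (AE x in M. 0 < w x)"

definition mean :: "'a measure \<Rightarrow> 'a set \<Rightarrow> ('a \<Rightarrow> ennreal) \<Rightarrow> ennreal" where
  "mean M B f = (\<integral>\<^sup>+x\<in>B. f x \<partial>M) / emeasure M B"

definition Muckenhoupt :: "'a::metric_space measure \<Rightarrow> real \<Rightarrow> ('a \<Rightarrow> real) set" where
  "Muckenhoupt M r =
     {w. weight M w \<and>
         (SUP (c, \<rho>) \<in> UNIV \<times> {0<..}.
            mean M (ball c \<rho>) (\<lambda>x. ennreal (w x)) *
            epowr (mean M (ball c \<rho>) (\<lambda>x. epowr (ennreal (w x)) (- 1 / (r - 1)))) (r - 1)) < \<infinity>}"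

definition Muckenhoupt_inf :: "'a::metric_space measure \<Rightarrow> ('a \<Rightarrow> real) set" where
  "Muckenhoupt_inf M = (\<Union>r\<in>{1<..}. Muckenhoupt M r)"

definition wmeasure :: "'a measure \<Rightarrow> ('a \<Rightarrow> real) \<Rightarrow> 'a set \<Rightarrow> ennreal" where
  "wmeasure M w E = (\<integral>\<^sup>+x\<in>E. ennreal (w x) \<partial>M)"

text \<open>Only nonnegative functions are needed here, namely the square functions \<open>sqfun M F\<close> below,
  which may take the value $\infty$.\<close>

definition Lnorm :: "'a measure \<Rightarrow> ('a \<Rightarrow> real) \<Rightarrow> real \<Rightarrow> ('a \<Rightarrow> ennreal) \<Rightarrow> ennreal" where
  "Lnorm M w r f = epowr (\<integral>\<^sup>+x. epowr (f x) r * ennreal (w x) \<partial>M) (1 / r)"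

definition Lspace :: "'a measure \<Rightarrow> ('a \<Rightarrow> real) \<Rightarrow> real \<Rightarrow> ('a \<Rightarrow> ennreal) set" where
  "Lspace M w r = {f \<in> borel_measurable M. Lnorm M w r f < \<infinity>}"

text \<open>The space $X \times (0,\infty)$ with the measure $d\mu(y)\,dt$. Functions on it are rendered as
  functions on \<open>'a \<times> real\<close> whose values at \<open>t \<le> 0\<close> are never used.\<close>

definition half_space :: "'a::metric_space measure \<Rightarrow> ('a \<times> real) measure" where
  "half_space M = M \<Otimes>\<^sub>M restrict_space lborel {0<..}"

definition cone :: "'a::metric_space \<Rightarrow> ('a \<times> real) set" where
  "cone x = {(y, t). 0 < t \<and> dist x y < t}"

definition sqfun :: "'a::metric_space measure \<Rightarrow> ('a \<times> real \<Rightarrow> complex) \<Rightarrow> 'a \<Rightarrow> ennreal" where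
  "sqfun M F x =
     epowr (\<integral>\<^sup>+z\<in>cone x. ennreal ((cmod (F z))\<^sup>2) / (vol M x (snd z) * ennreal (snd z))
              \<partial>half_space M) (1 / 2)"

definition tent_norm ::
  "'a::metric_space measure \<Rightarrow> ('a \<Rightarrow> real) \<Rightarrow> real \<Rightarrow> ('a \<times> real \<Rightarrow> complex) \<Rightarrow> ennreal" where
  "tent_norm M w r F = Lnorm M w r (sqfun M F)"

definition tent_space ::
  "'a::metric_space measure \<Rightarrow> ('a \<Rightarrow> real) \<Rightarrow> real \<Rightarrow> ('a \<times> real \<Rightarrow> complex) set" where
  "tent_space M w r = {F \<in> borel_measurable (half_space M). sqfun M F \<in> Lspace M w r}"

text \<open>The library sets \<open>infdist x {} = 0\<close>; this case is irrelevant when \<open>\<mu>(X) = \<infinity>\<close> and balls have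
  finite measure, since then no ball is the whole space.\<close>

definition tent :: "'a::metric_space set \<Rightarrow> ('a \<times> real) set" where
  "tent B = {(x, t). 0 < t \<and> t \<le> infdist x (- B)}"

text \<open>Closed support relative to $X \times (0,\infty)$.\<close>

definition half_supp :: "('a::metric_space \<times> real \<Rightarrow> complex) \<Rightarrow> ('a \<times> real) set" where
  "half_supp F = closure {z \<in> UNIV \<times> {0<..}. F z \<noteq> 0} \<inter> (UNIV \<times> {0<..})"

definition tent_atom ::
  "'a::metric_space measure \<Rightarrow> ('a \<Rightarrow> real) \<Rightarrow> real \<Rightarrow> real \<Rightarrow> ('a \<times> real \<Rightarrow> complex) \<Rightarrow> bool" where
  "tent_atom M w p q a \<longleftrightarrow>
     a \<in> borel_measurable (half_space M) \<and>
     (\<exists>c \<rho>. \<rho> > 0 \<and> half_supp a \<subseteq> tent (ball c \<rho>) \<and>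
        tent_norm M w q a \<le> epowr (wmeasure M w (ball c \<rho>)) (1 / q - 1 / p))"

definition lp_norm :: "real \<Rightarrow> (nat \<Rightarrow> complex) \<Rightarrow> ennreal" where
  "lp_norm p lam = epowr (\<Sum>j. ennreal (cmod (lam j) powr p)) (1 / p)"

end

theory Submission
  imports Defs
begin

text \<open>Write \<open>W\<close> for the measure \<open>w d\<mu>\<close>. The weight enters only through \<open>W\<close>, and through \<open>W\<close> only as
a doubling measure, which it is by the \<open>A\<^sub>r\<close> condition (\<open>doubling_density\<close>). Since
\<open>\<mu>\<close> has infinite mass, the space is unbounded, and then the doubling measure \<open>W\<close> has infinite mass
as well. The whole argument therefore concerns two doubling measures: \<open>M\<close>, which normalises the
square function, and \<open>W\<close>, with respect to which norms are taken. With
\<open>S\<^sub>\<alpha> u (x) = \<integral> u(y,t) / (V(x,t) t)\<close> over \<open>d(x,y) < \<alpha> t\<close> (called \<open>cone_int\<close> below) the square function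
of \<open>F\<close> is the root of \<open>S\<^sub>1 \<bar>F\<bar>\<^sup>2\<close>.

Sums of atoms. The square function is an \<open>L\<^sup>2\<close> norm for each fixed \<open>x\<close>, hence countably subadditive,
and \<open>s \<mapsto> s\<^sup>p\<close> is subadditive for \<open>p \<le> 1\<close>; so it is enough that an atom has \<open>T\<^sup>p\<close> norm at most one.
The square function of an atom vanishes off its ball, and there Young's inequality passes from \<open>q\<close>
to \<open>p\<close>. Convergence almost everywhere follows from Tonelli's theorem, because every
point \<open>(y,t)\<close> is seen by a ball of vertices \<open>x\<close> of positive \<open>W\<close>-measure (\<open>cone_int_0_imp\<close>).

Decomposition. Cut \<open>F\<close> along the sets \<open>O\<^sub>k = {S\<^sub>4 \<bar>F\<bar>\<^sup>2 > 4\<^sup>k}\<close>, defined with a cone wider than the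
one in the norm. Let \<open>G\<close> be the part of \<open>F\<close> outside the tent over \<open>O\<^bsub>k+1\<^esub>\<close>. A point
\<open>(y,t)\<close> of its support lies within distance \<open>t\<close> of the complement of \<open>O\<^bsub>k+1\<^esub>\<close>, so the truncated
narrow cone at any \<open>x\<close>, as far as \<open>G\<close> is concerned, lies in the wide cone at some \<open>x'\<close> outside
\<open>O\<^bsub>k+1\<^esub>\<close>. Hence the square function of \<open>G\<close> is bounded by a multiple of \<open>2\<^sup>k\<close> at every single point
(\<open>cone_int_le_of_level\<close>), and the pieces of \<open>F\<close> on tents over Whitney balls of \<open>O\<^sub>k\<close>, minus the tent
over \<open>O\<^bsub>k+1\<^esub>\<close>, are multiples of atoms for every \<open>q\<close> at once, because their
square functions are bounded.

The price is the wide cone in the definition of \<open>O\<^sub>k\<close>: the coefficients add up to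
\<open>\<Sum>\<^sub>k 2\<^sup>k\<^sup>p W(O\<^sub>k)\<close>, and this has to be compared with the narrow square function. The set
where \<open>U = {S\<^sub>1 > \<lambda>}\<close> has large \<open>W\<close>-density at some scale has measure at most a multiple of \<open>W(U)\<close> by
Vitali's covering argument (\<open>maximal_set\<close>), and off that set Tonelli's theorem bounds the integral of
\<open>S\<^sub>4\<close> by that of \<open>S\<^sub>1\<close> over \<open>{S\<^sub>1 \<le> \<lambda>}\<close> (\<open>aperture_off_maximal_set\<close>). Summing over \<open>\<lambda> = 4\<^sup>k\<close> leaves two
geometric series, which converge because \<open>0 < p/2 < 1\<close> (\<open>aperture_sum\<close>).\<close>

section \<open>Powers and geometric sums in [0, \<infinity>]\<close>

lemma epowr_ennreal: "0 < s \<Longrightarrow> 0 \<le> x \<Longrightarrow> epowr (ennreal x) s = ennreal (x powr s)"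
  by (simp add: epowr_def)

lemma epowr_top [simp]: "0 < s \<Longrightarrow> epowr top s = top"
  by (simp add: epowr_def)

lemma epowr_0 [simp]: "0 < s \<Longrightarrow> epowr 0 s = 0"
  by (simp add: epowr_def)

lemma epowr_one [simp]: "epowr a 1 = a"
  by (cases a) (auto simp: epowr_def)

lemma epowr_mono: "0 < s \<Longrightarrow> a \<le> b \<Longrightarrow> epowr a s \<le> epowr b s"
  by (cases a; cases b) (auto simp: epowr_ennreal top_unique intro!: powr_mono2 ennreal_leI)

lemma epowr_epowr: "0 < s \<Longrightarrow> 0 < t \<Longrightarrow> epowr (epowr a s) t = epowr a (s * t)"
  by (cases a) (auto simp: epowr_ennreal powr_powr)

lemma epowr_mult: "0 < s \<Longrightarrow> epowr (a * b) s = epowr a s * epowr b s"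
proof (cases a; cases b)
  fix x y assume "0 < s" "a = ennreal x" "0 \<le> x" "b = ennreal y" "0 \<le> y"
  then show ?thesis
    by (simp add: epowr_ennreal powr_mult flip: ennreal_mult)
next
  fix x assume *: "0 < s" "a = ennreal x" "0 \<le> x" "b = top"
  then show ?thesis
    by (cases "x = 0") (auto simp: epowr_ennreal ennreal_mult_top)
next
  fix x assume *: "0 < s" "b = ennreal x" "0 \<le> x" "a = top"
  then show ?thesis
    by (cases "x = 0") (auto simp: epowr_ennreal ennreal_top_mult)
qed simp

lemma epowr_less_top_iff: "0 < s \<Longrightarrow> epowr a s < top \<longleftrightarrow> a < top"
  by (cases a) (auto simp: epowr_ennreal)

lemma epowr_2: "epowr a 2 = a\<^sup>2"
  by (cases a) (auto simp: epowr_ennreal power2_eq_square ennreal_mult)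

lemma epowr_half_square [simp]: "(epowr a (1 / 2))\<^sup>2 = a"
  using epowr_epowr[of "1/2" 2 a] by (simp add: epowr_2)

lemma epowr_square_half [simp]: "epowr (a\<^sup>2) (1 / 2) = a"
  using epowr_epowr[of 2 "1/2" a] by (simp add: epowr_2)

lemma epowr_measurable [measurable]:
  assumes [measurable]: "f \<in> borel_measurable M"
  shows "(\<lambda>x. epowr (f x) s) \<in> borel_measurable M"
proof -
  have "(\<lambda>x. enn2real (f x) powr s) \<in> borel_measurable M"
    by (intro powr_real_measurable borel_measurable_enn2real) simp_all
  moreover have "Measurable.pred M (\<lambda>x. f x = \<infinity>)" "Measurable.pred M (\<lambda>x. f x = 0 \<and> s < 0)"
    by simp_all
  ultimately show ?thesis
    unfolding epowr_def by (intro measurable_If) (simp_all add: pred_def)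
qed

lemma epowr_add_le:
  assumes "0 < p" "p \<le> 1"
  shows "epowr (a + b) p \<le> epowr a p + epowr b p"
proof (cases a; cases b)
  fix x y assume xy: "a = ennreal x" "0 \<le> x" "b = ennreal y" "0 \<le> y"
  have "(x + y) powr p \<le> x powr p + y powr p"
  proof (cases "x + y = 0")
    case False
    let ?s = "x + y"
    have s: "?s > 0" using False xy by linarith
    have *: "z / ?s \<le> (z / ?s) powr p" if "0 \<le> z" "z \<le> ?s" for z
      using that powr_mono'[of p 1 "z / ?s"] assms s by (cases "z = 0") auto
    have "1 = x / ?s + y / ?s" using s by (simp flip: add_divide_distrib)
    also have "\<dots> \<le> (x / ?s) powr p + (y / ?s) powr p"
      using * xy by (intro add_mono) auto
    also have "\<dots> = (x powr p + y powr p) / ?s powr p"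
      using xy s by (simp add: powr_divide add_divide_distrib)
    finally show ?thesis using s by (simp add: field_simps)
  qed (use xy in auto)
  then show ?thesis
    using xy assms by (simp add: epowr_ennreal flip: ennreal_plus)
qed (use assms in auto)

lemma epowr_sum_le:
  assumes "0 < p" "p \<le> 1"
  shows "epowr (\<Sum>j\<in>A. f j) p \<le> (\<Sum>j\<in>A. epowr (f j) p)"
  using assms
proof (induction A rule: infinite_finite_induct)
  case (insert x A)
  then show ?case
    using epowr_add_le[OF assms, of "f x" "sum f A"] by (auto intro: order_trans add_left_mono)
qed auto

text \<open>The finite version is applied to partial sums in the form \<open>\<Sum> f \<le> (\<Sum> f\<^sup>p)\<^bsup>1/p\<^esup>\<close>, which is stable under
the supremum over partial sums.\<close>

lemma epowr_suminf_le:
  assumes p: "0 < p" "p \<le> 1"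
  shows "epowr (\<Sum>j. f j) p \<le> (\<Sum>j. epowr (f j) p)"
proof -
  have "(\<Sum>j. f j) \<le> epowr (\<Sum>j. epowr (f j) p) (1 / p)"
  proof (rule suminf_le_const)
    fix n
    have "(\<Sum>j<n. f j) = epowr (epowr (\<Sum>j<n. f j) p) (1 / p)"
      using p by (simp add: epowr_epowr)
    also have "\<dots> \<le> epowr (\<Sum>j. epowr (f j) p) (1 / p)"
      using p epowr_sum_le[OF p, of f "{..<n}"] sum_le_suminf[of "\<lambda>j. epowr (f j) p" "{..<n}"]
      by (intro epowr_mono) (auto intro: order_trans)
    finally show "(\<Sum>j<n. f j) \<le> epowr (\<Sum>j. epowr (f j) p) (1 / p)" .
  qed auto
  then have "epowr (\<Sum>j. f j) p \<le> epowr (epowr (\<Sum>j. epowr (f j) p) (1 / p)) p"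
    using p by (intro epowr_mono) auto
  then show ?thesis using p by (simp add: epowr_epowr)
qed

lemma geometric_sum_atMost:
  assumes "0 < b"
  shows "(\<integral>\<^sup>+k. ennreal (4 powr (b * real_of_int k)) * indicator {..K} k \<partial>count_space UNIV)
      = ennreal (4 powr (b * K) / (1 - 4 powr - b))"
proof -
  have bij: "bij_betw (\<lambda>j::nat. K - int j) UNIV {..K}"
    by (rule bij_betwI[where g="\<lambda>k. nat (K - k)"]) auto
  have lt: "4 powr - b < (1::real)"
    using assms powr_less_mono[of "-b" 0 4] by simp
  have "(\<integral>\<^sup>+k. ennreal (4 powr (b * real_of_int k)) * indicator {..K} k \<partial>count_space UNIV)
     = (\<integral>\<^sup>+k. ennreal (4 powr (b * real_of_int k)) \<partial>count_space {..K})"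
    by (simp add: nn_integral_count_space_indicator)
  also have "\<dots> = (\<integral>\<^sup>+j. ennreal (4 powr (b * real_of_int (K - int j))) \<partial>count_space UNIV)"
    by (simp add: nn_integral_bij_count_space[OF bij, symmetric])
  also have "\<dots> = (\<Sum>j. ennreal (4 powr (b * real_of_int (K - int j))))"
    by (rule nn_integral_count_space_nat)
  also have "\<dots> = (\<Sum>j. ennreal (4 powr (b * K) * (4 powr - b) ^ j))"
  proof (rule suminf_cong)
    fix j
    have "4 powr (b * real_of_int (K - int j)) = 4 powr (b * K + (- b) * real j)"
      by (simp add: algebra_simps)
    also have "\<dots> = 4 powr (b * K) * (4 powr - b) ^ j"
      unfolding powr_add by (simp add: powr_powr powr_realpow[symmetric])
    finally show "ennreal (4 powr (b * real_of_int (K - int j))) = ennreal (4 powr (b * K) * (4 powr - b) ^ j)"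
      by simp
  qed
  also have "\<dots> = ennreal (4 powr (b * K) * (1 / (1 - 4 powr - b)))"
    using lt by (intro suminf_ennreal_eq sums_mult geometric_sums) auto
  finally show ?thesis by simp
qed

text \<open>The series is dominated by its largest term, that of the largest \<open>k\<close> with \<open>4\<^sup>k < a\<close>. Together with
the next lemma it turns sums over dyadic levels into powers of \<open>a\<close>.\<close>

lemma geometric_sum_below:
  assumes "0 < b"
  shows "(\<integral>\<^sup>+k. ennreal (4 powr (b * real_of_int k)) * indicator {k. ennreal (4 powr real_of_int k) < a} k
            \<partial>count_space UNIV) \<le> ennreal (1 / (1 - 4 powr - b)) * epowr a b"
proof (cases a)
  case (real x)
  have lt: "4 powr - b < (1::real)"
    using assms powr_less_mono[of "-b" 0 4] by simp
  show ?thesis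
  proof (cases "x = 0")
    case False
    then have x: "x > 0" using real by auto
    define K where "K = \<lceil>log 4 x\<rceil> - 1"
    have "{k. ennreal (4 powr real_of_int k) < a} = {..K}"
    proof -
      have "ennreal (4 powr real_of_int k) < a \<longleftrightarrow> k \<le> K" for k
        using x real by (simp add: K_def ennreal_less_iff powr_less_iff[of 4] less_ceiling_iff[symmetric])
      then show ?thesis by auto
    qed
    moreover have "4 powr (b * K) \<le> x powr b"
    proof -
      have "real_of_int K \<le> log 4 x" by (simp add: K_def)
      then have "4 powr (real_of_int K) \<le> x" using x by (simp add: le_log_iff)
      then have "(4 powr (real_of_int K)) powr b \<le> x powr b"
        using assms by (intro powr_mono2) auto
      then show ?thesis by (simp add: powr_powr mult.commute)
    qed
    ultimately show ?thesis
      using real assms lt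
      by (simp add: geometric_sum_atMost epowr_ennreal divide_right_mono flip: ennreal_mult)
  qed (use real assms in \<open>simp\<close>)
next
  case top
  have "4 powr - b < (1::real)"
    using assms powr_less_mono[of "-b" 0 4] by simp
  then show ?thesis using top assms by (simp add: ennreal_mult_top)
qed

text \<open>Here the largest term is the first one, \<open>4\<^sup>k \<approx> a\<close>, of size \<open>a\<^bsup>-b\<^esup>\<close>; the remaining factor \<open>a\<close> is kept on
the left so that the case \<open>a = \<infinity>\<close>, with an empty sum, needs no exception.\<close>

lemma geometric_sum_above:
  assumes "0 < b" "b < 1"
  shows "(\<integral>\<^sup>+k. ennreal (4 powr (- b * real_of_int k)) * indicator {k. a \<le> ennreal (4 powr real_of_int k)} k
            \<partial>count_space UNIV) * a \<le> ennreal (1 / (1 - 4 powr - b)) * epowr a (1 - b)"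
proof (cases a)
  case (real x)
  have lt: "4 powr - b < (1::real)"
    using assms powr_less_mono[of "-b" 0 4] by simp
  show ?thesis
  proof (cases "x = 0")
    case False
    then have x: "x > 0" using real by auto
    define L where "L = \<lceil>log 4 x\<rceil>"
    have bij: "bij (uminus :: int \<Rightarrow> int)"
      by (rule bij_betwI[where g=uminus]) auto
    have mem: "a \<le> ennreal (4 powr real_of_int k) \<longleftrightarrow> L \<le> k" for k
      using x real by (simp add: L_def log_le_iff[symmetric] ceiling_le_iff)
    have "(\<integral>\<^sup>+k. ennreal (4 powr (- b * real_of_int k)) * indicator {k. a \<le> ennreal (4 powr real_of_int k)} k
            \<partial>count_space UNIV)
       = (\<integral>\<^sup>+k. ennreal (4 powr (b * real_of_int k)) * indicator {..-L} k \<partial>count_space UNIV)"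
      by (subst nn_integral_bij_count_space[OF bij, symmetric], intro nn_integral_cong)
         (auto simp: mem indicator_def)
    also have "\<dots> = ennreal (4 powr (- b * L) / (1 - 4 powr - b))"
      using assms by (simp add: geometric_sum_atMost)
    also have "\<dots> \<le> ennreal (x powr - b / (1 - 4 powr - b))"
    proof -
      have "x \<le> 4 powr (real_of_int L)" using x
        by (simp add: L_def log_le_iff[symmetric])
      then have "(4 powr (real_of_int L)) powr -b \<le> x powr -b"
        using assms x by (intro powr_mono2') auto
      then show ?thesis using lt by (simp add: powr_powr mult.commute divide_right_mono)
    qed
    finally have "(\<integral>\<^sup>+k. ennreal (4 powr (- b * real_of_int k)) * indicator {k. a \<le> ennreal (4 powr real_of_int k)} k
            \<partial>count_space UNIV) * a \<le> ennreal (x powr - b / (1 - 4 powr - b)) * a"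
      by (rule mult_right_mono) simp
    also have "\<dots> = ennreal (1 / (1 - 4 powr - b)) * epowr a (1 - b)"
    proof -
      have "x powr - b * x = x powr (1 - b)"
        using x by (simp add: powr_diff powr_minus divide_inverse)
      then show ?thesis
        using real assms lt by (simp add: epowr_ennreal flip: ennreal_mult)
    qed
    finally show ?thesis .
  qed (use real assms in \<open>simp\<close>)
next
  case top
  have "4 powr - b < (1::real)"
    using assms powr_less_mono[of "-b" 0 4] by simp
  then show ?thesis using top assms by (simp add: ennreal_mult_top)
qed

section \<open>Doubling measures\<close>

text \<open>The constant is a parameter of the locale because the bounds for atomic decompositions must not
depend on the function that is decomposed. Taking it at least 1 makes its powers monotone.\<close>

locale doubling =
  fixes N :: "'a::metric_space measure" and C :: real
  assumes sets_N [measurable_cong, simp]: "sets N = sets borel"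
    and C_ge_1: "1 \<le> C"
    and double: "0 < r \<Longrightarrow> emeasure N (ball x (2 * r)) \<le> ennreal C * emeasure N (ball x r)"
    and finite_ball: "emeasure N (ball x r) < \<infinity>"
    and nonzero: "emeasure N UNIV \<noteq> 0"
begin

lemma space_N [simp]: "space N = UNIV"
  using sets_eq_imp_space_eq[OF sets_N] by simp

lemma ball_power:
  assumes "0 < r"
  shows "emeasure N (ball x (2 ^ k * r)) \<le> ennreal (C ^ k) * emeasure N (ball x r)"
proof (induction k)
  case (Suc k)
  have "emeasure N (ball x (2 ^ Suc k * r)) \<le> ennreal C * emeasure N (ball x (2 ^ k * r))"
    using double[of "2 ^ k * r" x] assms by (simp add: mult.assoc)
  also have "\<dots> \<le> ennreal C * (ennreal (C ^ k) * emeasure N (ball x r))"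
    by (intro mult_left_mono Suc) simp
  also have "\<dots> = ennreal (C ^ Suc k) * emeasure N (ball x r)"
    using C_ge_1 by (simp add: ennreal_mult mult.assoc)
  finally show ?case .
qed simp

lemma ball_compare:
  assumes "0 < r" "s + dist x y \<le> 2 ^ k * r"
  shows "emeasure N (ball y s) \<le> ennreal (C ^ k) * emeasure N (ball x r)"
proof -
  have "ball y s \<subseteq> ball x (2 ^ k * r)"
  proof
    fix z assume "z \<in> ball y s"
    then show "z \<in> ball x (2 ^ k * r)"
      using assms(2) dist_triangle[of x z y] by simp
  qed
  then have "emeasure N (ball y s) \<le> emeasure N (ball x (2 ^ k * r))"
    by (intro emeasure_mono) auto
  then show ?thesis using ball_power[OF assms(1), of x k] by (rule order_trans)
qed

lemma UN_ball: "(\<Union>n::nat. ball x (real n)) = UNIV"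
  using reals_Archimedean2 by auto

text \<open>If one ball were null, then by doubling all its dilates would be, and they exhaust the space.\<close>

lemma ball_pos: assumes "0 < r" shows "0 < emeasure N (ball x r)"
proof (rule ccontr)
  assume "\<not> ?thesis"
  then have 0: "emeasure N (ball x r) = 0" by simp
  have "emeasure N (ball x (real n)) = 0" for n
  proof -
    obtain k where "real n / r < 2 ^ k" using real_arch_pow[of 2] by auto
    then have "real n + dist x x \<le> 2 ^ k * r" using assms by (simp add: field_simps)
    from ball_compare[OF assms this] show ?thesis using 0 by simp
  qed
  then have "emeasure N (\<Union>n::nat. ball x (real n)) = 0"
    by (intro emeasure_UN_eq_0) auto
  then show False using nonzero UN_ball[of x] by simp
qed

lemma ball_real:
  assumes "0 < r" obtains b where "0 < b" "emeasure N (ball x r) = ennreal b"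
proof (cases "emeasure N (ball x r)")
  case (real b)
  then show ?thesis using ball_pos[OF assms, of x] that[of b] by simp
next
  case top
  then show ?thesis using finite_ball[of x r] by simp
qed

lemma sigma_finite: "sigma_finite_measure N"
proof
  fix x :: 'a
  show "\<exists>A. countable A \<and> A \<subseteq> sets N \<and> \<Union>A = space N \<and> (\<forall>a\<in>A. emeasure N a \<noteq> \<infinity>)"
    using finite_ball UN_ball[of x]
    by (intro exI[of _ "range (\<lambda>n::nat. ball x (real n))"]) (auto simp: less_top[symmetric])
qed

text \<open>Packing: balls of radius \<open>s/2\<close> about separated points are disjoint, and each carries a fixed
fraction of the mass of \<open>ball x R\<close>. Separability of the space rests on this bound.\<close>

lemma separated_finite:
  fixes x :: 'a
  assumes s: "0 < s" and sep: "\<And>x y. x \<in> S \<Longrightarrow> y \<in> S \<Longrightarrow> x \<noteq> y \<Longrightarrow> s \<le> dist x y"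
  shows "finite (S \<inter> ball x R)"
proof (cases "0 < R")
  case True
  obtain b where b: "0 < b" "emeasure N (ball x R) = ennreal b" by (rule ball_real[OF True])
  obtain U where U: "0 < U" "emeasure N (ball x (R + s)) = ennreal U"
    by (rule ball_real[of "R + s"]) (use True s in auto)
  \<comment> \<open>With this \<open>k\<close>, \<open>2\<^sup>k\<close>-fold dilates of the small balls about points of \<open>ball x R\<close> contain \<open>ball x R\<close>.\<close>
  obtain k where k: "2 * R / (s / 2) < 2 ^ k" using real_arch_pow[of 2] by auto
  have "finite (S \<inter> ball x R) \<and> card (S \<inter> ball x R) \<le> nat \<lfloor>C ^ k * U / b\<rfloor>"
  proof (rule finite_if_finite_subsets_card_bdd)
    fix T assume T: "T \<subseteq> S \<inter> ball x R" "finite T"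
    have disj: "disjoint_family_on (\<lambda>n. ball n (s / 2)) T"
    proof (unfold disjoint_family_on_def, intro ballI impI)
      fix m n assume "m \<in> T" "n \<in> T" "m \<noteq> n"
      then have "s \<le> dist m n" using sep T by auto
      then show "ball m (s / 2) \<inter> ball n (s / 2) = {}"
      proof (intro equals0I)
        fix z assume "z \<in> ball m (s / 2) \<inter> ball n (s / 2)"
        then show False using \<open>s \<le> dist m n\<close> dist_triangle[of m n z] by (simp add: dist_commute)
      qed
    qed
    have "ennreal (card T * b) = (\<Sum>n\<in>T. emeasure N (ball x R))"
      using b by (simp add: ennreal_mult ennreal_of_nat_eq_real_of_nat)
    also have "\<dots> \<le> (\<Sum>n\<in>T. ennreal (C ^ k) * emeasure N (ball n (s / 2)))"
    proof (intro sum_mono ball_compare)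
      fix n assume "n \<in> T"
      then have "dist n x < R" using T by (auto simp: dist_commute)
      then show "R + dist n x \<le> 2 ^ k * (s / 2)"
        using k s by (simp add: field_simps)
    qed (use s in auto)
    also have "\<dots> = ennreal (C ^ k) * emeasure N (\<Union>n\<in>T. ball n (s / 2))"
      using T disj by (subst sum_emeasure[symmetric]) (auto simp: sum_distrib_left)
    also have "\<dots> \<le> ennreal (C ^ k) * emeasure N (ball x (R + s))"
    proof (intro mult_left_mono emeasure_mono)
      show "(\<Union>n\<in>T. ball n (s / 2)) \<subseteq> ball x (R + s)"
      proof safe
        fix n z assume "n \<in> T" "z \<in> ball n (s / 2)"
        then show "z \<in> ball x (R + s)"
          using T dist_triangle[of x z n] s by (auto dest!: subsetD)
      qed
    qed auto
    also have "\<dots> = ennreal (C ^ k * U)"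
      using U C_ge_1 by (simp add: ennreal_mult)
    finally have "card T * b \<le> C ^ k * U"
      using U C_ge_1 by (simp add: ennreal_le_iff)
    then have "real (card T) \<le> C ^ k * U / b" using b by (simp add: field_simps)
    then show "card T \<le> nat \<lfloor>C ^ k * U / b\<rfloor>" by (simp add: le_nat_floor)
  qed
  then show ?thesis by simp
next
  case False
  then have "ball x R = {}" by simp
  then show ?thesis by (simp only: Int_empty_right finite.emptyI)
qed

text \<open>A maximal \<open>s\<close>-separated set; it is countable by the packing bound. A sequence enumerating it may
repeat points, so separation is required of distinct points rather than of distinct indices.\<close>

lemma exists_net:
  assumes s: "0 < s"
  shows "\<exists>\<nu>::nat \<Rightarrow> 'a. (\<forall>x. \<exists>i. dist x (\<nu> i) < s) \<and> (\<forall>i j. \<nu> i \<noteq> \<nu> j \<longrightarrow> s \<le> dist (\<nu> i) (\<nu> j))"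
proof -
  let ?sep = "\<lambda>S. \<forall>x\<in>S. \<forall>y\<in>S. x \<noteq> y \<longrightarrow> s \<le> dist x (y::'a)"
  have "\<exists>S\<in>Collect ?sep. \<forall>X\<in>Collect ?sep. S \<subseteq> X \<longrightarrow> X = S"
  proof (rule subset_Zorn')
    fix \<C> assume chain: "subset.chain (Collect ?sep) \<C>"
    have "s \<le> dist x y" if "A \<in> \<C>" "x \<in> A" "B \<in> \<C>" "y \<in> B" "x \<noteq> y" for x y A B
    proof -
      have "\<C> \<subseteq> Collect ?sep" using chain by (simp add: subset_chain_def)
      then have "?sep A" "?sep B" using that(1,3) by (simp_all add: subset_iff)
      moreover have "A \<subseteq> B \<or> B \<subseteq> A" using that chain by (simp add: subset_chain_def)
      ultimately show ?thesis using that by (meson subsetD)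
    qed
    then show "\<Union>\<C> \<in> Collect ?sep" unfolding mem_Collect_eq by (meson UnionE)
  qed
  then obtain S where S: "?sep S" and max: "\<And>X. ?sep X \<Longrightarrow> S \<subseteq> X \<Longrightarrow> X = S"
    unfolding Bex_def Ball_def mem_Collect_eq by blast
  have cover: "\<exists>y\<in>S. dist x y < s" for x
  proof (rule ccontr)
    assume *: "\<not> ?thesis"
    then have far: "s \<le> dist x y" if "y \<in> S" for y using that by (simp add: not_less)
    have "?sep (insert x S)"
    proof (intro ballI impI)
      fix y z assume "y \<in> insert x S" "z \<in> insert x S" "y \<noteq> z"
      then show "s \<le> dist y z" using S far[of y] far[of z] by (cases "y = x"; cases "z = x") (simp_all add: dist_commute)
    qed
    then have "insert x S = S" using max subset_insertI by metis
    then show False using far[of x] s by (metis dist_self insertI1 not_less)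
  qed
  have "countable (S \<inter> ball x (real n))" for x n
    using S by (intro countable_finite separated_finite[OF s]) auto
  then have "countable (\<Union>n::nat. S \<inter> ball x (real n))" for x
    by (intro countable_UN) simp_all
  then have "countable S" unfolding Int_UN_distrib[symmetric] UN_ball by simp
  moreover have "S \<noteq> {}" using cover by blast
  ultimately have ran: "range (from_nat_into S) = S" by (rule range_from_nat_into[rotated])
  show ?thesis
  proof (intro exI[of _ "from_nat_into S"] conjI allI impI)
    show "\<exists>i. dist x (from_nat_into S i) < s" for x using cover ran by (metis imageE)
    show "s \<le> dist (from_nat_into S i) (from_nat_into S j)"
      if "from_nat_into S i \<noteq> from_nat_into S j" for i j using S ran that by blast
  qed
qed

lemma exists_dense: "\<exists>D. countable D \<and> (\<forall>x. \<forall>e>0. \<exists>d\<in>D. dist x (d::'a) < e)"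
proof -
  have "\<forall>n::nat. \<exists>\<nu>::nat \<Rightarrow> 'a. \<forall>x. \<exists>i. dist x (\<nu> i) < 1 / (Suc n)"
    using exists_net by (metis of_nat_0_less_iff zero_less_Suc zero_less_divide_1_iff)
  then obtain \<nu> :: "nat \<Rightarrow> nat \<Rightarrow> 'a" where \<nu>: "\<And>n x. \<exists>i. dist x (\<nu> n i) < 1 / (Suc n)"
    by metis
  show ?thesis
  proof (intro exI[of _ "\<Union>n. range (\<nu> n)"] conjI allI impI)
    fix x and e :: real assume "e > 0"
    then obtain n where "1 / (Suc n) < e" by (metis nat_approx_posE)
    moreover obtain i where "dist x (\<nu> n i) < 1 / (Suc n)" using \<nu> by blast
    ultimately show "\<exists>d\<in>\<Union>n. range (\<nu> n). dist x d < e"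
      by (intro bexI[of _ "\<nu> n i"]) auto
  qed auto
qed

end

text \<open>Far from a given ball there is a ball of comparable mass, because a bounded dilate of it contains the
first. A dilate of the first ball containing both has mass larger by a fixed factor \<open>c > 1\<close>; iterate.\<close>

lemma (in doubling) infinite_if_unbounded:
  assumes unb: "\<And>x r. ball x r \<noteq> (UNIV :: 'a set)"
  shows "emeasure N UNIV = \<infinity>"
proof (rule ccontr)
  assume fin: "emeasure N UNIV \<noteq> \<infinity>"
  fix x :: 'a
  \<comment> \<open>\<open>ball y (D/2)\<close> has at least the \<open>C\<^bsup>-3\<^esup>\<close>-fold mass of \<open>ball x R\<close>, since its 8-fold dilate contains it.\<close>
  define c where "c = 1 + 1 / C ^ 3"
  have c: "c > 1" using C_ge_1 by (simp add: c_def)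
  have grow: "\<exists>R'>0. ennreal c * emeasure N (ball x R) \<le> emeasure N (ball x R')" if "R > 0" for R
  proof -
    obtain y where y: "y \<notin> ball x (2 * R)" using unb by blast
    define D where "D = dist x y"
    have D: "D \<ge> 2 * R" using y by (simp add: D_def)
    have "emeasure N (ball x R) \<le> ennreal (C ^ 3) * emeasure N (ball y (D / 2))"
      using D that by (intro ball_compare) (auto simp: D_def dist_commute)
    then have "ennreal (1 / C ^ 3) * emeasure N (ball x R)
        \<le> ennreal (1 / C ^ 3) * (ennreal (C ^ 3) * emeasure N (ball y (D / 2)))"
      by (rule mult_left_mono) simp
    also have "\<dots> = emeasure N (ball y (D / 2))"
      using C_ge_1 by (simp add: mult.assoc[symmetric] flip: ennreal_mult)
    finally have y_large: "ennreal (1 / C ^ 3) * emeasure N (ball x R) \<le> emeasure N (ball y (D / 2))" .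
    have "ennreal c * emeasure N (ball x R)
        = emeasure N (ball x R) + ennreal (1 / C ^ 3) * emeasure N (ball x R)"
      using C_ge_1 by (simp add: c_def ennreal_plus distrib_right del: ennreal_plus[symmetric])
    also have "\<dots> \<le> emeasure N (ball x R) + emeasure N (ball y (D / 2))"
      by (rule add_left_mono[OF y_large])
    also have "\<dots> = emeasure N (ball x R \<union> ball y (D / 2))"
    proof (rule plus_emeasure)
      show "ball x R \<inter> ball y (D / 2) = {}"
      proof (intro equals0I)
        fix z assume "z \<in> ball x R \<inter> ball y (D / 2)"
        then show False using D dist_triangle[of x y z] by (simp add: D_def dist_commute)
      qed
    qed auto
    also have "\<dots> \<le> emeasure N (ball x (2 * D))"
    proof (rule emeasure_mono)
      show "ball x R \<union> ball y (D / 2) \<subseteq> ball x (2 * D)"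
      proof safe
        fix z assume "z \<in> ball y (D / 2)"
        then show "z \<in> ball x (2 * D)" using D that dist_triangle[of x z y] by (simp add: D_def)
      qed (use D that in auto)
    qed auto
    finally show ?thesis using D that by (intro exI[of _ "2 * D"]) auto
  qed
  have "\<exists>R>0. ennreal (c ^ n) * emeasure N (ball x 1) \<le> emeasure N (ball x R)" for n
  proof (induction n)
    case (Suc n)
    then obtain R where R: "R > 0" "ennreal (c ^ n) * emeasure N (ball x 1) \<le> emeasure N (ball x R)"
      by auto
    from grow[OF R(1)] obtain R' where R': "R' > 0"
      "ennreal c * emeasure N (ball x R) \<le> emeasure N (ball x R')" by auto
    have "ennreal (c ^ Suc n) * emeasure N (ball x 1) = ennreal c * (ennreal (c ^ n) * emeasure N (ball x 1))"
      using c by (simp add: ennreal_mult mult.assoc)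
    also have "\<dots> \<le> emeasure N (ball x R')"
      using R'(2) mult_left_mono[OF R(2), of "ennreal c"] by (auto intro: order_trans)
    finally show ?case using R'(1) by auto
  qed (auto intro!: exI[of _ 1])
  moreover have "emeasure N (ball x R) \<le> emeasure N UNIV" for R
    by (intro emeasure_mono) auto
  ultimately have le: "ennreal (c ^ n) * emeasure N (ball x 1) \<le> emeasure N UNIV" for n
    by (meson order_trans)
  obtain b where b: "0 < b" "emeasure N (ball x 1) = ennreal b" by (rule ball_real[of 1]) auto
  obtain U where U: "emeasure N UNIV = ennreal U" "U \<ge> 0"
    using fin by (cases "emeasure N UNIV") auto
  have "c ^ n * b \<le> U" for n
    using le[of n] b U c by (simp add: ennreal_le_iff flip: ennreal_mult)
  moreover obtain n where "U / b < c ^ n" using real_arch_pow[OF c] by blast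
  ultimately show False using b by (auto simp: field_simps not_le[symmetric])
qed

section \<open>Muckenhoupt weights define doubling measures\<close>

lemma doubling_of_doubling_measure:
  assumes "doubling_measure M" "emeasure M (space M) = \<infinity>"
  shows "\<exists>A. doubling M A"
proof -
  obtain C where sets: "sets M = sets borel" and C: "C > 0"
    and dbl: "\<And>x r. r > 0 \<Longrightarrow> vol M x (2 * r) \<le> ennreal C * vol M x r \<and> vol M x r < \<infinity>"
    using assms(1) unfolding doubling_measure_def by blast
  have "doubling M (max 1 C)"
  proof
    show "emeasure M (ball x (2 * r)) \<le> ennreal (max 1 C) * emeasure M (ball x r)" if "0 < r" for x r
      using dbl[OF that, of x] mult_right_mono[of "ennreal C" "ennreal (max 1 C)" "vol M x r"]
      by (auto simp: vol_def intro: order_trans ennreal_leI)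
    show "emeasure M (ball x r) < \<infinity>" for x r
    proof (cases "0 < r")
      case False
      then have "ball x r = {}" by simp
      then show ?thesis by (simp only: emeasure_empty) simp
    qed (use dbl[of r x] in \<open>simp add: vol_def\<close>)
    show "emeasure M UNIV \<noteq> 0"
      using assms(2) sets_eq_imp_space_eq[OF sets] by simp
  qed (use sets in auto)
  then show ?thesis by blast
qed

lemma (in doubling) nn_integral_ball_pos:
  assumes [measurable]: "f \<in> borel_measurable N" and pos: "AE x in N. 0 < f x" and r: "0 < r"
  shows "0 < (\<integral>\<^sup>+x\<in>ball y r. f x \<partial>N)"
proof (rule ccontr)
  have [measurable]: "(\<lambda>x. f x * indicator (ball y r) x) \<in> borel_measurable N"
    by (intro borel_measurable_times_ennreal borel_measurable_indicator) simp_all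
  assume "\<not> ?thesis"
  then have "AE x in N. f x * indicator (ball y r) x = 0"
    by (subst (asm) not_gr_zero, subst (asm) nn_integral_0_iff_AE) simp_all
  then have "AE x in N. x \<notin> ball y r"
    using pos by eventually_elim (auto simp: indicator_def split: if_splits)
  then have "emeasure N (ball y r) = 0"
    by (subst (asm) AE_iff_measurable[of "ball y r"]) auto
  then show False using ball_pos[OF r, of y] by simp
qed

text \<open>For \<open>E \<subseteq> B\<close> the condition \<open>A\<^sub>r\<close> gives \<open>(\<mu>(E)/\<mu>(B))\<^sup>r \<le> K W(E)/W(B)\<close>, by Hoelder's inequality for
\<open>1 = w\<^bsup>1/r\<^esup> w\<^bsup>-1/r\<^esup>\<close> on \<open>E\<close>. With \<open>E\<close> and \<open>B\<close> concentric balls of radii \<open>\<rho>\<close> and \<open>2\<rho>\<close> this is doubling.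
Hoelder's inequality appears as a pointwise Young inequality with a free parameter \<open>l\<close>, fixed after
integration.\<close>

lemma doubling_density:
  assumes dbl: "doubling M A" and r: "1 < r" and w: "w \<in> Muckenhoupt M r"
  shows "\<exists>C. doubling (density M (\<lambda>x. ennreal (w x))) C"
proof -
  interpret M: doubling M A by (rule dbl)
  define \<sigma> where "\<sigma> x = epowr (ennreal (w x)) (- 1 / (r - 1))" for x
  have w_meas [measurable]: "w \<in> borel_measurable M" and w_nonneg: "\<And>x. 0 \<le> w x"
    and w_int: "\<And>x \<rho>. set_integrable M (ball x \<rho>) w" and w_pos: "AE x in M. 0 < w x"
    using w by (auto simp: Muckenhoupt_def weight_def)
  have \<sigma>_meas [measurable]: "\<sigma> \<in> borel_measurable M"
    unfolding \<sigma>_def by (intro epowr_measurable) measurable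
  have [measurable]: "(\<lambda>x. indicator (ball y \<rho>) x :: ennreal) \<in> borel_measurable M" for y \<rho>
    by (intro borel_measurable_indicator) simp
  let ?W = "density M (\<lambda>x. ennreal (w x))"
  have W_ball: "emeasure ?W (ball x \<rho>) = (\<integral>\<^sup>+y\<in>ball x \<rho>. ennreal (w y) \<partial>M)" for x \<rho>
    by (rule emeasure_density) auto
  have W_fin: "emeasure ?W (ball x \<rho>) < \<infinity>" for x \<rho>
  proof -
    have "(\<integral>\<^sup>+y. ennreal (norm (indicator (ball x \<rho>) y *\<^sub>R w y)) \<partial>M) < \<infinity>"
      using w_int[of x \<rho>] unfolding set_integrable_def integrable_iff_bounded by simp
    moreover have "(\<integral>\<^sup>+y. ennreal (norm (indicator (ball x \<rho>) y *\<^sub>R w y)) \<partial>M) = (\<integral>\<^sup>+y\<in>ball x \<rho>. ennreal (w y) \<partial>M)"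
      by (intro nn_integral_cong) (auto simp: indicator_def w_nonneg)
    ultimately show ?thesis by (simp add: W_ball)
  qed
  have W_pos: "0 < emeasure ?W (ball x \<rho>)" if "0 < \<rho>" for x \<rho>
    unfolding W_ball by (rule M.nn_integral_ball_pos[OF _ _ that]) (use w_pos in auto)
  \<comment> \<open>At zeros of \<open>w\<close> the right-hand side is \<open>\<infinity>\<close>, by the convention for negative powers of 0.\<close>
  have young: "1 \<le> ennreal (l / r) * ennreal (w x) + ennreal ((1 - 1 / r) * l powr (- 1 / (r - 1))) * \<sigma> x" if l: "0 < l" for l x
  proof (cases "w x = 0")
    case True
    then have "\<sigma> x = \<infinity>" using r by (simp add: \<sigma>_def epowr_def)
    then show ?thesis using r l by (simp add: ennreal_mult_top)
  next
    case False
    then have wx: "0 < w x" using w_nonneg[of x] by simp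
    let ?v = "l * w x"
    have "?v powr (1 / r) * (?v powr (- 1 / (r - 1))) powr (1 - 1 / r)
        \<le> 1 / r * ?v + (1 - 1 / r) * ?v powr (- 1 / (r - 1))"
      using wx l r by (intro Youngs_inequality_0) auto
    moreover have "?v powr (1 / r) * (?v powr (- 1 / (r - 1))) powr (1 - 1 / r) = 1"
    proof -
      have "1 / r + (- 1 / (r - 1)) * (1 - 1 / r) = 0" using r by (simp add: field_simps)
      then show ?thesis using wx l by (simp add: powr_powr powr_add[symmetric])
    qed
    ultimately have "1 \<le> l / r * w x + (1 - 1 / r) * l powr (- 1 / (r - 1)) * w x powr (- 1 / (r - 1))"
      using wx l by (simp add: powr_mult mult.assoc)
    moreover define c where "c = (1 - 1 / r) * l powr (- 1 / (r - 1))"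
    ultimately have "ennreal 1 \<le> ennreal (l / r * w x + c * w x powr (- 1 / (r - 1)))"
      by (intro ennreal_leI) simp
    also have "\<dots> = ennreal (l / r * w x) + ennreal (c * w x powr (- 1 / (r - 1)))"
      using r l wx by (intro ennreal_plus) (auto simp: c_def)
    also have "\<dots> = ennreal (l / r) * ennreal (w x) + ennreal c * ennreal (w x powr (- 1 / (r - 1)))"
      using r l wx by (intro arg_cong2[where f = "(+)"] ennreal_mult) (auto simp: c_def)
    also have "ennreal (w x powr (- 1 / (r - 1))) = \<sigma> x"
      using wx by (simp add: \<sigma>_def epowr_def)
    finally show ?thesis by (simp add: c_def)
  qed
  define S where "S = (SUP (c, \<rho>) \<in> UNIV \<times> {0<..}.
            mean M (ball c \<rho>) (\<lambda>x. ennreal (w x)) * epowr (mean M (ball c \<rho>) \<sigma>) (r - 1))"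
  have "S < \<infinity>" using w by (simp add: Muckenhoupt_def S_def \<sigma>_def[abs_def])
  then obtain K where K: "S = ennreal K" "0 \<le> K" by (cases S) auto
  define C where "C = max 1 (K * A powr r)"
  have dbl_W: "emeasure ?W (ball x (2 * \<rho>)) \<le> ennreal C * emeasure ?W (ball x \<rho>)" if \<rho>: "0 < \<rho>" for x \<rho>
  proof -
    have \<rho>2: "0 < 2 * \<rho>" using \<rho> by simp
    obtain m where m: "0 < m" "emeasure M (ball x (2 * \<rho>)) = ennreal m" using M.ball_real[OF \<rho>2] .
    obtain m' where m': "0 < m'" "emeasure M (ball x \<rho>) = ennreal m'" using M.ball_real[OF \<rho>] .
    have mm': "m \<le> A * m'"
      using M.double[OF \<rho>, of x] m m' M.C_ge_1 by (simp flip: ennreal_mult)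
    obtain b where b: "0 < b" "emeasure ?W (ball x (2 * \<rho>)) = ennreal b"
      using W_fin[of x "2 * \<rho>"] W_pos[OF \<rho>2, of x] by (cases "emeasure ?W (ball x (2 * \<rho>))") auto
    obtain e where e: "0 < e" "emeasure ?W (ball x \<rho>) = ennreal e"
      using W_fin[of x \<rho>] W_pos[OF \<rho>, of x] by (cases "emeasure ?W (ball x \<rho>)") auto
    have "mean M (ball x (2 * \<rho>)) (\<lambda>x. ennreal (w x)) * epowr (mean M (ball x (2 * \<rho>)) \<sigma>) (r - 1) \<le> S"
      unfolding S_def by (rule SUP_upper2[of "(x, 2 * \<rho>)"]) (use \<rho> in auto)
    then have A_r: "ennreal (b / m) * epowr ((\<integral>\<^sup>+y\<in>ball x (2 * \<rho>). \<sigma> y \<partial>M) / ennreal m) (r - 1) \<le> ennreal K"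
      using b m K by (simp add: mean_def W_ball[symmetric] divide_ennreal)
    have \<sigma>_fin: "(\<integral>\<^sup>+y\<in>ball x (2 * \<rho>). \<sigma> y \<partial>M) \<noteq> \<infinity>"
    proof
      assume "(\<integral>\<^sup>+y\<in>ball x (2 * \<rho>). \<sigma> y \<partial>M) = \<infinity>"
      then show False using A_r b m r by (simp add: ennreal_top_divide ennreal_mult_top top_unique)
    qed
    moreover have "0 < (\<integral>\<^sup>+y\<in>ball x (2 * \<rho>). \<sigma> y \<partial>M)"
    proof (rule M.nn_integral_ball_pos[OF \<sigma>_meas _ \<rho>2])
      show "AE y in M. 0 < \<sigma> y" using w_pos by eventually_elim (simp add: \<sigma>_def epowr_def)
    qed
    ultimately obtain \<tau> where \<tau>: "0 < \<tau>" "(\<integral>\<^sup>+y\<in>ball x (2 * \<rho>). \<sigma> y \<partial>M) = ennreal \<tau>"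
      by (cases "(\<integral>\<^sup>+y\<in>ball x (2 * \<rho>). \<sigma> y \<partial>M)") auto
    have large: "b * \<tau> powr (r - 1) \<le> K * m powr r"
    proof -
      have "ennreal (b / m * (\<tau> / m) powr (r - 1)) \<le> ennreal K"
        using A_r \<tau> m b r by (simp add: divide_ennreal epowr_ennreal flip: ennreal_mult)
      then have "b / m * (\<tau> / m) powr (r - 1) \<le> K" using K by simp
      moreover have "b / m * (\<tau> / m) powr (r - 1) = b * \<tau> powr (r - 1) / m powr r"
        using m \<tau> by (simp add: powr_divide powr_diff)
      ultimately have "b * \<tau> powr (r - 1) / m powr r \<le> K" by (simp only:)
      then show ?thesis using m by (simp add: divide_le_eq)
    qed
    have small: "m' powr r \<le> \<tau> powr (r - 1) * e"
    proof -
      \<comment> \<open>This \<open>l\<close> makes the term with \<open>\<tau>\<close> equal to \<open>(1 - 1/r) m'\<close>, which is absorbed on the left.\<close>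
      define l where "l = (\<tau> / m') powr (r - 1)"
      have l: "0 < l" using \<tau> m' by (simp add: l_def)
      define c where "c = (1 - 1 / r) * l powr (- 1 / (r - 1))"
      have c: "0 \<le> c" using r by (simp add: c_def)
      have "ennreal m' = (\<integral>\<^sup>+y. 1 * indicator (ball x \<rho>) y \<partial>M)" using m' by simp
      also have "\<dots> \<le> (\<integral>\<^sup>+y. ennreal (l / r) * (ennreal (w y) * indicator (ball x \<rho>) y)
           + ennreal c * (\<sigma> y * indicator (ball x (2 * \<rho>)) y) \<partial>M)"
        using young[OF l] \<rho> by (intro nn_integral_mono) (auto simp: indicator_def c_def)
      also have "\<dots> = (\<integral>\<^sup>+y. ennreal (l / r) * (ennreal (w y) * indicator (ball x \<rho>) y) \<partial>M)
           + (\<integral>\<^sup>+y. ennreal c * (\<sigma> y * indicator (ball x (2 * \<rho>)) y) \<partial>M)"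
        by (rule nn_integral_add) measurable
      also have "\<dots> = ennreal (l / r) * (\<integral>\<^sup>+y\<in>ball x \<rho>. ennreal (w y) \<partial>M)
           + ennreal c * (\<integral>\<^sup>+y\<in>ball x (2 * \<rho>). \<sigma> y \<partial>M)"
        by (intro arg_cong2[where f = "(+)"] nn_integral_cmult) measurable
      also have "\<dots> = ennreal (l / r) * ennreal e + ennreal c * ennreal \<tau>"
        by (simp only: W_ball[symmetric] e(2) \<tau>(2))
      also have "\<dots> = ennreal (l / r * e + c * \<tau>)"
      proof -
        have "ennreal (l / r * e + c * \<tau>) = ennreal (l / r * e) + ennreal (c * \<tau>)"
          using l r e(1) \<tau>(1) c by (intro ennreal_plus) auto
        moreover have "ennreal (l / r * e) = ennreal (l / r) * ennreal e"
          using l r e(1) by (intro ennreal_mult) auto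
        moreover have "ennreal (c * \<tau>) = ennreal c * ennreal \<tau>"
          using \<tau>(1) c by (intro ennreal_mult) auto
        ultimately show ?thesis by (simp only:)
      qed
      finally have "m' \<le> l / r * e + c * \<tau>"
        using l r e(1) \<tau>(1) c by (subst (asm) ennreal_le_iff) simp_all
      moreover have "c * \<tau> = (1 - 1 / r) * m'"
      proof -
        have "l powr (- 1 / (r - 1)) = m' / \<tau>"
          using r \<tau>(1) m'(1) by (simp add: l_def powr_powr powr_minus)
        then show ?thesis using \<tau>(1) by (simp add: c_def)
      qed
      ultimately have "m' \<le> l / r * e + (1 - 1 / r) * m'" by simp
      then have "m' \<le> l * e" using r by (simp add: field_simps)
      also have "l * e = \<tau> powr (r - 1) / m' powr (r - 1) * e"
        using \<tau> m' by (simp add: l_def powr_divide)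
      finally have "m' * m' powr (r - 1) \<le> \<tau> powr (r - 1) * e"
        using m' by (simp add: field_simps)
      then show ?thesis using m' by (simp add: powr_diff)
    qed
    have "b * m' powr r \<le> b * (\<tau> powr (r - 1) * e)"
      using small b by (intro mult_left_mono) auto
    also have "\<dots> = (b * \<tau> powr (r - 1)) * e" by (simp add: mult.assoc)
    also have "\<dots> \<le> K * m powr r * e"
      using large e by (intro mult_right_mono) auto
    also have "\<dots> \<le> K * (A * m') powr r * e"
      using mm' m r K e by (intro mult_right_mono mult_left_mono powr_mono2) auto
    also have "\<dots> = K * A powr r * e * m' powr r"
      using M.C_ge_1 m' by (simp add: powr_mult)
    finally have "b \<le> K * A powr r * e" using m' by simp
    also have "\<dots> \<le> C * e" using e by (intro mult_right_mono) (auto simp: C_def)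
    finally show ?thesis using b e by (simp add: C_def ennreal_leI flip: ennreal_mult)
  qed
  have "doubling ?W C"
  proof
    show "emeasure ?W UNIV \<noteq> 0"
    proof
      assume "emeasure ?W UNIV = 0"
      moreover have "emeasure ?W (ball undefined 1) \<le> emeasure ?W UNIV" by (intro emeasure_mono) auto
      ultimately show False using W_pos[of 1 undefined] by simp
    qed
  qed (use dbl_W W_fin in \<open>auto simp: C_def\<close>)
  then show ?thesis by blast
qed

section \<open>Integrals over cones\<close>

text \<open>The weight \<open>1/(V(x,t) t)\<close> on the cone of aperture \<open>\<alpha>\<close> at \<open>x\<close>. It is kept as a function of the pair
\<open>(x,z)\<close>, because the arguments below integrate it in either variable.\<close>

definition cone_kernel :: "'a::metric_space measure \<Rightarrow> real \<Rightarrow> 'a \<Rightarrow> 'a \<times> real \<Rightarrow> ennreal" where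
  "cone_kernel M \<alpha> x z =
     indicator {z. 0 < snd z \<and> dist x (fst z) < \<alpha> * snd z} z * inverse (vol M x (snd z) * ennreal (snd z))"

definition cone_int :: "'a::metric_space measure \<Rightarrow> real \<Rightarrow> ('a \<times> real \<Rightarrow> ennreal) \<Rightarrow> 'a \<Rightarrow> ennreal" where
  "cone_int M \<alpha> u x = (\<integral>\<^sup>+z. u z * cone_kernel M \<alpha> x z \<partial>half_space M)"

lemma sqfun_eq_cone_int:
  "sqfun M F x = epowr (cone_int M 1 (\<lambda>z. ennreal ((cmod (F z))\<^sup>2)) x) (1 / 2)"
proof -
  have "{z. 0 < snd z \<and> dist x (fst z) < 1 * snd z} = cone x"
    by (auto simp: cone_def)
  then show ?thesis
    by (simp add: sqfun_def cone_int_def cone_kernel_def divide_ennreal_def mult_ac)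
qed

lemma ennreal_inverse_le_cmult:
  fixes a b :: ennreal
  assumes "a \<le> ennreal c * b" "0 < c"
  shows "inverse b \<le> ennreal c * inverse a"
proof -
  have antimono: "inverse y \<le> inverse x" if le: "x \<le> y" for x y :: ennreal
  proof (cases "x = 0 \<or> y = top")
    case False
    then obtain b where b: "y = ennreal b" "0 \<le> b" by (cases y) auto
    then obtain a where a: "x = ennreal a" "0 \<le> a" using le by (cases x) (auto simp: top_unique)
    have "0 < a" using False a by (simp add: order_less_le)
    moreover have "a \<le> b" using le a b by simp
    ultimately show ?thesis using a b by (simp add: inverse_ennreal)
  qed auto
  have "ennreal c * inverse (ennreal c * b) \<le> ennreal c * inverse a"
    by (rule mult_left_mono[OF antimono[OF assms(1)]]) simp
  moreover have "ennreal c * inverse (ennreal c * b) = (ennreal c * inverse (ennreal c)) * inverse b"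
    using assms(2) by (subst ennreal_inverse_mult') (auto simp: mult.assoc)
  moreover have "ennreal c * inverse (ennreal c) = 1"
    using assms(2) by (simp add: ennreal_divide_self flip: divide_ennreal_def)
  ultimately show ?thesis by simp
qed

context doubling
begin

text \<open>Measurability with respect to a product of Borel algebras depends on separability, which here is a
consequence of doubling: \<open>dist x y < a\<close> is a countable disjunction, over a dense set, of conditions
\<open>dist x d + dist y d < a\<close> that involve \<open>x\<close> and \<open>y\<close> separately.\<close>

lemma dist_measurable:
  assumes f: "f \<in> measurable K borel" and g: "g \<in> measurable K borel"
  shows "(\<lambda>x. dist (f x) (g x :: 'a)) \<in> borel_measurable K"
proof (rule borel_measurable_iff_less[THEN iffD2, rule_format])
  fix a :: real
  obtain D where D: "countable D" "\<And>x e. 0 < e \<Longrightarrow> \<exists>d\<in>D. dist x (d::'a) < e"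
    using exists_dense by blast
  have dist_const: "(\<lambda>x. dist (h x) d) \<in> borel_measurable K" if "h \<in> measurable K borel" for h and d :: 'a
    by (rule measurable_compose[OF that]) (intro borel_measurable_continuous_onI continuous_intros)
  have "dist x y < a \<longleftrightarrow> (\<exists>d\<in>D. dist x d + dist y d < a)" for x y :: 'a
  proof
    assume "dist x y < a"
    then obtain d where "d \<in> D" "dist x d < (a - dist x y) / 2"
      using D(2)[of "(a - dist x y) / 2" x] by auto
    moreover from this have "dist x d + dist y d < a"
      using dist_triangle[of y d x] by (simp add: dist_commute field_simps)
    ultimately show "\<exists>d\<in>D. dist x d + dist y d < a" by blast
  next
    assume "\<exists>d\<in>D. dist x d + dist y d < a"
    then obtain d where "dist x d + dist y d < a" by blast
    then show "dist x y < a" using dist_triangle2[of x y d] by simp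
  qed
  then have "{x \<in> space K. dist (f x) (g x) < a}
      = (\<Union>d\<in>D. {x \<in> space K. dist (f x) d + dist (g x) d < a})" by auto
  also have "\<dots> \<in> sets K"
    using D(1) by (intro sets.countable_UN'' borel_measurable_less borel_measurable_add dist_const f g
        borel_measurable_const)
  finally show "{x \<in> space K. dist (f x) (g x) < a} \<in> sets K" .
qed

lemma vol_measurable:
  assumes [measurable]: "f \<in> measurable K borel" "g \<in> borel_measurable K"
  shows "(\<lambda>x. vol N (f x) (g x)) \<in> borel_measurable K"
proof -
  interpret sigma_finite_measure N by (rule sigma_finite)
  have [measurable]: "(\<lambda>p. dist (f (fst p)) (snd p)) \<in> borel_measurable (K \<Otimes>\<^sub>M N)"
    by (intro dist_measurable) (auto intro: measurable_compose[OF measurable_fst] measurable_compose[OF measurable_snd measurable_ident_sets])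
  have "vol N (f x) (g x) = (\<integral>\<^sup>+y. (if dist (f x) y < g x then 1 else 0) \<partial>N)" for x
  proof -
    have "vol N (f x) (g x) = (\<integral>\<^sup>+y. indicator (ball (f x) (g x)) y \<partial>N)"
      unfolding vol_def by (intro nn_integral_indicator[symmetric]) simp
    also have "\<dots> = (\<integral>\<^sup>+y. (if dist (f x) y < g x then 1 else 0) \<partial>N)"
      by (intro nn_integral_cong) (simp add: indicator_def)
    finally show ?thesis .
  qed
  moreover have "(\<lambda>x. \<integral>\<^sup>+y. (if dist (f x) y < g x then 1 else 0) \<partial>N) \<in> borel_measurable K"
    by (rule borel_measurable_nn_integral) (simp add: case_prod_unfold)
  ultimately show ?thesis by simp
qed

lemma space_half_space: "space (half_space N) = UNIV \<times> {0<..}"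
  by (simp add: half_space_def space_pair_measure space_restrict_space)

lemma fst_half_space: "fst \<in> measurable (half_space N) borel"
  unfolding half_space_def using measurable_fst[of N] by (simp add: measurable_cong_sets[OF refl sets_N])

lemma snd_half_space: "snd \<in> borel_measurable (half_space N)"
  unfolding half_space_def
  by (rule measurable_compose[OF measurable_snd]) (rule measurable_restrict_space1, simp)

lemma sigma_finite_half_space: "sigma_finite_measure (half_space N)"
proof -
  interpret N: sigma_finite_measure N by (rule sigma_finite)
  interpret L: sigma_finite_measure "restrict_space lborel {0<..} :: real measure"
    by (intro sigma_finite_measure_restrict_space) (auto intro: lborel.sigma_finite_measure_axioms)
  interpret pair_sigma_finite N "restrict_space lborel {0<..} :: real measure" ..
  show ?thesis unfolding half_space_def by (rule sigma_finite_measure_axioms)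
qed

lemma cone_kernel_measurable:
  assumes [measurable]: "f \<in> measurable K borel" "g \<in> measurable K (half_space N)"
  shows "(\<lambda>x. cone_kernel N \<alpha> (f x) (g x)) \<in> borel_measurable K"
proof -
  have [measurable]: "(\<lambda>x. fst (g x)) \<in> measurable K borel" "(\<lambda>x. snd (g x)) \<in> borel_measurable K"
    using fst_half_space snd_half_space by (auto intro: measurable_compose[OF assms(2)])
  have [measurable]: "(\<lambda>x. dist (f x) (fst (g x))) \<in> borel_measurable K"
    "(\<lambda>x. vol N (f x) (snd (g x))) \<in> borel_measurable K"
    by (intro dist_measurable vol_measurable; measurable)+
  have "(\<lambda>x. indicator {z. 0 < snd z \<and> dist (f x) (fst z) < \<alpha> * snd z} (g x) :: ennreal)
     = indicator {x. 0 < snd (g x) \<and> dist (f x) (fst (g x)) < \<alpha> * snd (g x)}"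
    by (auto simp: indicator_def fun_eq_iff)
  then show ?thesis unfolding cone_kernel_def by simp
qed

lemma cone_int_measurable:
  assumes "u \<in> borel_measurable (half_space N)"
  shows "cone_int N \<alpha> u \<in> borel_measurable borel"
proof -
  interpret H: sigma_finite_measure "half_space N" by (rule sigma_finite_half_space)
  have "(\<lambda>(x, z). u z * cone_kernel N \<alpha> x z) \<in> borel_measurable (borel \<Otimes>\<^sub>M half_space N)"
    using assms unfolding case_prod_unfold
    by (intro borel_measurable_times_ennreal cone_kernel_measurable)
       (auto intro: measurable_compose[OF measurable_snd])
  then show ?thesis unfolding cone_int_def[abs_def] by (rule H.borel_measurable_nn_integral)
qed

text \<open>Volumes \<open>V(x,t)\<close> and \<open>V(y,t)\<close> are comparable when \<open>d(x,y)\<close> is at most a multiple of \<open>t\<close>, so inside a cone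
the kernel depends on its vertex only up to a factor.\<close>

lemma inverse_vol_compare:
  assumes "0 < t" "t + dist x y \<le> 2 ^ k * t"
  shows "inverse (vol N x t * ennreal t) \<le> ennreal (C ^ k) * inverse (vol N y t * ennreal t)"
proof (rule ennreal_inverse_le_cmult)
  have "vol N y t \<le> ennreal (C ^ k) * vol N x t"
    unfolding vol_def by (rule ball_compare[OF assms])
  then show "vol N y t * ennreal t \<le> ennreal (C ^ k) * (vol N x t * ennreal t)"
    by (simp add: mult.assoc[symmetric] mult_right_mono)
  show "0 < C ^ k" using C_ge_1 by simp
qed

lemma inverse_vol_pos: "0 < t \<Longrightarrow> 0 < inverse (vol N x t * ennreal t)"
  using finite_ball[of x t] by (simp add: ennreal_inverse_positive vol_def ennreal_mult_eq_top_iff less_top)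

end

section \<open>Vitali covering and the maximal set\<close>

text \<open>Select a ball of maximal radius, discard those that meet it, which are contained in its threefold
dilate, and continue with the remaining balls.\<close>

lemma finite_vitali:
  fixes c :: "'i \<Rightarrow> 'a::metric_space"
  assumes "finite I" "\<And>i. i \<in> I \<Longrightarrow> 0 < r i"
  shows "\<exists>J\<subseteq>I. disjoint_family_on (\<lambda>i. ball (c i) (r i)) J \<and>
           (\<Union>i\<in>I. ball (c i) (r i)) \<subseteq> (\<Union>i\<in>J. ball (c i) (3 * r i))"
  using assms
proof (induction I rule: finite_psubset_induct)
  case (psubset I)
  show ?case
  proof (cases "I = {}")
    case False
    obtain i where i: "i \<in> I" "\<And>j. j \<in> I \<Longrightarrow> r j \<le> r i"
    proof -
      have "Max (r ` I) \<in> r ` I" using psubset.hyps False by (intro Max_in) auto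
      then obtain i where "i \<in> I" "r i = Max (r ` I)" by auto
      moreover have "r j \<le> Max (r ` I)" if "j \<in> I" for j using psubset.hyps that by simp
      ultimately show thesis using that by metis
    qed
    define I' where "I' = {j \<in> I. ball (c i) (r i) \<inter> ball (c j) (r j) = {}}"
    have "i \<notin> I'" using psubset.prems[OF i(1)] by (auto simp: I'_def)
    moreover have "I' \<subseteq> I" by (auto simp: I'_def)
    ultimately have "I' \<subset> I" using i(1) by blast
    then obtain J where J: "J \<subseteq> I'" "disjoint_family_on (\<lambda>i. ball (c i) (r i)) J"
      "(\<Union>i\<in>I'. ball (c i) (r i)) \<subseteq> (\<Union>i\<in>J. ball (c i) (3 * r i))"
      using psubset.IH[of I'] psubset.prems by (auto simp: I'_def)
    show ?thesis
    proof (intro exI[of _ "insert i J"] conjI)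
      show "insert i J \<subseteq> I" using J(1) i(1) by (auto simp: I'_def)
      show "disjoint_family_on (\<lambda>i. ball (c i) (r i)) (insert i J)"
        using J(1,2) by (auto simp: disjoint_family_on_def I'_def)
      show "(\<Union>i\<in>I. ball (c i) (r i)) \<subseteq> (\<Union>j\<in>insert i J. ball (c j) (3 * r j))"
      proof safe
        fix j z assume j: "j \<in> I" "z \<in> ball (c j) (r j)"
        show "z \<in> (\<Union>j\<in>insert i J. ball (c j) (3 * r j))"
        proof (cases "j \<in> I'")
          case True
          then have "z \<in> (\<Union>i\<in>J. ball (c i) (3 * r i))" using J(3) j(2) by blast
          then show ?thesis by blast
        next
          case False
          then obtain v where "v \<in> ball (c i) (r i)" "v \<in> ball (c j) (r j)"
            using j by (auto simp: I'_def)
          then have "dist (c i) z < 3 * r i"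
            using j i(2)[OF j(1)] dist_triangle[of "c i" z v] dist_triangle[of v z "c j"]
            by (simp add: dist_commute)
          then show ?thesis by auto
        qed
      qed
    qed
  qed (auto simp: disjoint_family_on_def)
qed

context doubling
begin

lemma union_dense_balls_finite:
  assumes U: "U \<in> sets N" and \<gamma>: "0 < \<gamma>" and I: "finite I"
    and B: "\<And>i. i \<in> I \<Longrightarrow> 0 < r i \<and> ennreal \<gamma> * emeasure N (ball (c i) (r i)) \<le> emeasure N (ball (c i) (r i) \<inter> U)"
  shows "emeasure N (\<Union>i\<in>I. ball (c i) (r i)) \<le> ennreal (C\<^sup>2 / \<gamma>) * emeasure N U"
proof -
  obtain J where J: "J \<subseteq> I" "disjoint_family_on (\<lambda>i. ball (c i) (r i)) J"
      "(\<Union>i\<in>I. ball (c i) (r i)) \<subseteq> (\<Union>i\<in>J. ball (c i) (3 * r i))"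
    using finite_vitali[OF I, of r c] B by metis
  have fJ: "finite J" using J(1) I by (rule finite_subset)
  have "emeasure N (\<Union>i\<in>I. ball (c i) (r i)) \<le> emeasure N (\<Union>i\<in>J. ball (c i) (3 * r i))"
    using fJ by (intro emeasure_mono J(3)) auto
  also have "\<dots> \<le> (\<Sum>i\<in>J. emeasure N (ball (c i) (3 * r i)))"
    using fJ by (intro emeasure_subadditive_finite) auto
  also have "\<dots> \<le> (\<Sum>i\<in>J. ennreal (C\<^sup>2 / \<gamma>) * emeasure N (ball (c i) (r i) \<inter> U))"
  proof (rule sum_mono)
    fix i assume "i \<in> J"
    then have i: "0 < r i" "ennreal \<gamma> * emeasure N (ball (c i) (r i)) \<le> emeasure N (ball (c i) (r i) \<inter> U)"
      using B J(1) by auto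
    have "emeasure N (ball (c i) (3 * r i)) \<le> ennreal (C\<^sup>2) * emeasure N (ball (c i) (r i))"
      using i by (intro ball_compare) auto
    also have "\<dots> = ennreal (C\<^sup>2 / \<gamma>) * (ennreal \<gamma> * emeasure N (ball (c i) (r i)))"
      using \<gamma> by (simp add: mult.assoc[symmetric] flip: ennreal_mult)
    also have "\<dots> \<le> ennreal (C\<^sup>2 / \<gamma>) * emeasure N (ball (c i) (r i) \<inter> U)"
      using i by (intro mult_left_mono) auto
    finally show "emeasure N (ball (c i) (3 * r i)) \<le> ennreal (C\<^sup>2 / \<gamma>) * emeasure N (ball (c i) (r i) \<inter> U)" .
  qed
  also have "\<dots> = ennreal (C\<^sup>2 / \<gamma>) * emeasure N (\<Union>i\<in>J. ball (c i) (r i) \<inter> U)"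
  proof -
    have "(\<Sum>i\<in>J. emeasure N (ball (c i) (r i) \<inter> U)) = emeasure N (\<Union>i\<in>J. ball (c i) (r i) \<inter> U)"
      using J(2) fJ U by (intro sum_emeasure) (auto simp: disjoint_family_on_def)
    then show ?thesis by (simp add: sum_distrib_left[symmetric])
  qed
  also have "\<dots> \<le> ennreal (C\<^sup>2 / \<gamma>) * emeasure N U"
    using U by (intro mult_left_mono emeasure_mono) auto
  finally show ?thesis .
qed

text \<open>The radii may be unbounded, so no ball of maximal radius need exist; but the bound for finite
subfamilies is uniform and passes to the union.\<close>

lemma union_dense_balls:
  assumes U: "U \<in> sets N" and \<gamma>: "0 < \<gamma>" and I: "countable I"
    and B: "\<And>i. i \<in> I \<Longrightarrow> 0 < r i \<and> ennreal \<gamma> * emeasure N (ball (c i) (r i)) \<le> emeasure N (ball (c i) (r i) \<inter> U)"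
  shows "emeasure N (\<Union>i\<in>I. ball (c i) (r i)) \<le> ennreal (C\<^sup>2 / \<gamma>) * emeasure N U"
proof (cases "I = {}")
  case False
  define e where "e = from_nat_into I"
  have e: "range e = I" unfolding e_def using range_from_nat_into[OF False I] .
  define X where "X n = (\<Union>i\<in>e ` {..n}. ball (c i) (r i))" for n
  have "emeasure N (X n) \<le> ennreal (C\<^sup>2 / \<gamma>) * emeasure N U" for n
    unfolding X_def using B e by (intro union_dense_balls_finite U \<gamma>) auto
  then have "(SUP n. emeasure N (X n)) \<le> ennreal (C\<^sup>2 / \<gamma>) * emeasure N U"
    by (rule SUP_least)
  moreover have "(SUP n. emeasure N (X n)) = emeasure N (\<Union>n. X n)"
  proof (rule SUP_emeasure_incseq)
    show "incseq X" unfolding incseq_def X_def by (intro allI impI UN_mono image_mono) auto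
  qed (auto simp: X_def)
  moreover have "(\<Union>n. X n) = (\<Union>i\<in>I. ball (c i) (r i))"
    unfolding X_def e[symmetric] by auto
  ultimately show ?thesis by simp
qed simp

text \<open>\<open>Us\<close> is the superlevel set of the (uncentred, \<open>N\<close>-weighted) Hardy--Littlewood maximal function of the
indicator of \<open>U\<close>, restricted to countably many balls to make measurability evident. If \<open>ball y (4t)\<close>
contains a point outside \<open>Us\<close>, then \<open>U\<close> is sparse in a ball of radius about \<open>5t\<close>, hence fills at most
half of \<open>ball y t\<close>. The factor 4 is the aperture that the change of aperture needs.\<close>

lemma maximal_set:
  assumes U: "U \<in> sets borel"
  shows "\<exists>Us\<in>sets borel. emeasure N Us \<le> ennreal (2 * C ^ 5) * emeasure N U \<and>
     (\<forall>y t. 0 < t \<longrightarrow> \<not> ball y (4 * t) \<subseteq> Us \<longrightarrow> emeasure N (ball y t) \<le> 2 * emeasure N (ball y t - U))"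
proof -
  obtain D where D: "countable D" "\<And>x e. 0 < e \<Longrightarrow> \<exists>d\<in>D. dist x (d::'a) < e"
    using exists_dense by blast
  \<comment> \<open>The ball in which \<open>U\<close> is sparse lies in \<open>ball y (8t)\<close>, whence \<open>C\<^sup>3\<close>; the 2 yields one half.\<close>
  define \<gamma> where "\<gamma> = 1 / (2 * C ^ 3)"
  have \<gamma>: "\<gamma> > 0" using C_ge_1 by (simp add: \<gamma>_def)
  define I where "I = {(d, r). d \<in> D \<and> r \<in> \<rat> \<and> 0 < r \<and>
      ennreal \<gamma> * emeasure N (ball d r) \<le> emeasure N (ball d r \<inter> U)}"
  have I: "countable I"
    by (rule countable_subset[of _ "D \<times> \<rat>"]) (auto simp: I_def D(1) countable_rat)
  define Us where "Us = (\<Union>i\<in>I. ball (fst i) (snd i))"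
  have "emeasure N Us \<le> ennreal (C\<^sup>2 / \<gamma>) * emeasure N U"
    unfolding Us_def using U by (intro union_dense_balls I \<gamma>) (auto simp: I_def)
  moreover have "C\<^sup>2 / \<gamma> = 2 * C ^ 5"
    by (simp add: \<gamma>_def power_add[symmetric])
  moreover have "Us \<in> sets borel" unfolding Us_def by (intro borel_open) auto
  moreover have "emeasure N (ball y t) \<le> 2 * emeasure N (ball y t - U)"
    if t: "0 < t" and nsub: "\<not> ball y (4 * t) \<subseteq> Us" for y t
  proof -
    from nsub obtain x where "x \<in> ball y (4 * t)" and x': "x \<notin> Us" by blast
    then have x: "dist y x < 4 * t" by simp
    obtain d where d: "d \<in> D" "dist y d < t" using D(2)[OF t] by blast
    \<comment> \<open>The centre is within \<open>t\<close> of \<open>y\<close>, so radii above \<open>5t\<close> reach \<open>x\<close> and radii below \<open>7t\<close> stay in \<open>ball y (8t)\<close>.\<close>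
    obtain r where r: "r \<in> \<rat>" "5 * t < r" "r < 6 * t" using Rats_dense_in_real[of "5 * t" "6 * t"] t by auto
    have "x \<in> ball d r" using d r x dist_triangle[of d x y] by (simp add: dist_commute)
    then have "(d, r) \<notin> I" using x' by (auto simp: Us_def)
    then have sparse: "emeasure N (ball d r \<inter> U) \<le> ennreal \<gamma> * emeasure N (ball d r)"
      using d r t by (auto simp: I_def)
    obtain b where b: "0 < b" "emeasure N (ball y t) = ennreal b" using ball_real[OF t] .
    have "ball y t \<subseteq> ball d r"
    proof
      fix z assume "z \<in> ball y t"
      then show "z \<in> ball d r" using d r dist_triangle[of d z y] t by (simp add: dist_commute)
    qed
    then have "emeasure N (ball y t \<inter> U) \<le> emeasure N (ball d r \<inter> U)"
      using U by (intro emeasure_mono) auto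
    also note sparse
    also have "ennreal \<gamma> * emeasure N (ball d r) \<le> ennreal \<gamma> * (ennreal (C ^ 3) * emeasure N (ball y t))"
      using d r t by (intro mult_left_mono ball_compare) auto
    also have "\<dots> = ennreal (b / 2)"
      using C_ge_1 b by (simp add: \<gamma>_def flip: ennreal_mult)
    finally have half: "emeasure N (ball y t \<inter> U) \<le> ennreal (b / 2)" .
    have "ennreal b = emeasure N (ball y t \<inter> U) + emeasure N (ball y t - U)"
      using U b by (subst plus_emeasure) (auto intro!: arg_cong[where f = "emeasure N"] simp flip: b(2))
    also have "\<dots> \<le> ennreal (b / 2) + emeasure N (ball y t - U)"
      by (rule add_right_mono[OF half])
    finally have *: "ennreal b \<le> ennreal (b / 2) + emeasure N (ball y t - U)" .
    show ?thesis
    proof (cases "emeasure N (ball y t - U)")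
      case (real a)
      then have "b \<le> b / 2 + a" using * b by (simp flip: ennreal_plus)
      then have "ennreal b \<le> ennreal (2 * a)" by (intro ennreal_leI) simp
      then show ?thesis using b real by (simp add: ennreal_mult)
    qed (simp add: ennreal_mult_top)
  qed
  ultimately show ?thesis by auto
qed

end

section \<open>Whitney balls\<close>

lemma infdist_lessE:
  assumes "E \<noteq> {}" "infdist x E < r"
  obtains a where "a \<in> E" "dist x a < r"
proof -
  have "(INF a\<in>E. dist x a) < r" using assms by (simp add: infdist_notempty)
  then show thesis using that assms(1) by (subst (asm) cINF_less_iff) auto
qed

lemma le_infdistI:
  assumes "E \<noteq> {}" "\<And>a. a \<in> E \<Longrightarrow> r \<le> dist x a"
  shows "r \<le> infdist x E"
  using assms by (auto simp: infdist_notempty intro: cINF_greatest)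

text \<open>Points of the complement of \<open>E\<close> are sorted by the dyadic size of their distance to \<open>E\<close> and,
within one layer, by the nearest point of a net of comparable scale. A point lies in few of the
halved balls: its own distance to \<open>E\<close> leaves three possible scales, and halved balls of one scale
are disjoint. Layers are used rather than a greedy selection by size because the distances to \<open>E\<close> can
be unbounded even if the complement of \<open>E\<close> has finite measure.\<close>

lemma (in doubling) whitney:
  assumes E: "E \<noteq> {}" "E \<in> sets borel"
  shows "\<exists>(c :: int \<times> nat \<Rightarrow> 'a) r R. (\<forall>i. 0 < r i) \<and>
     (\<forall>i. R i \<in> sets borel) \<and> disjoint_family R \<and> (\<Union>i. R i) = {y. 0 < infdist y E} \<and>
     (\<forall>i. \<forall>y\<in>R i. dist y (c i) < r i \<and> infdist y E \<le> 16 * r i) \<and>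
     (\<integral>\<^sup>+i. (if R i = {} then 0 else emeasure N (ball (c i) (32 * r i))) \<partial>count_space UNIV)
        \<le> ennreal (3 * C ^ 6) * emeasure N (- E)"
proof -
  have "\<forall>m::int. \<exists>\<nu>::nat \<Rightarrow> 'a. (\<forall>x. \<exists>i. dist x (\<nu> i) < 2 powr m) \<and> (\<forall>i j. \<nu> i \<noteq> \<nu> j \<longrightarrow> 2 powr m \<le> dist (\<nu> i) (\<nu> j))"
    using exists_net by simp
  then obtain \<nu> :: "int \<Rightarrow> nat \<Rightarrow> 'a" where
    cover: "\<And>m x. \<exists>i. dist x (\<nu> m i) < 2 powr m" and
    sep: "\<And>m i j. \<nu> m i \<noteq> \<nu> m j \<Longrightarrow> 2 powr m \<le> dist (\<nu> m i) (\<nu> m j)" by metis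
  define c where "c i = \<nu> (fst i) (snd i)" for i
  \<comment> \<open>Disjointification leaves an empty cell at each repetition of a net point.\<close>
  define cell where "cell m = disjointed (\<lambda>j. ball (\<nu> m j) (2 powr m))" for m
  define layer where "layer m = {y. 8 * 2 powr real_of_int m \<le> infdist y E \<and> infdist y E < 16 * 2 powr real_of_int m}" for m
  define R where "R i = cell (fst i) (snd i) \<inter> layer (fst i)" for i
  have layer_iff: "y \<in> layer m \<longleftrightarrow> 0 < infdist y E \<and> m = \<lfloor>log 2 (infdist y E)\<rfloor> - 3" for y m
  proof (cases "0 < infdist y E")
    case True
    have "8 * 2 powr real_of_int m = 2 powr real_of_int (m + 3)" "16 * 2 powr real_of_int m = 2 powr real_of_int (m + 4)"
      by (simp_all add: powr_add)
    then have "y \<in> layer m \<longleftrightarrow> real_of_int (m + 3) \<le> log 2 (infdist y E) \<and> log 2 (infdist y E) < real_of_int (m + 4)"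
      using True by (simp only: layer_def mem_Collect_eq) (simp add: le_log_iff log_less_iff)
    also have "\<dots> \<longleftrightarrow> \<lfloor>log 2 (infdist y E)\<rfloor> = m + 3" by (simp add: floor_eq_iff) linarith
    finally show ?thesis using True by auto
  next
    case False
    have "0 < 8 * 2 powr real_of_int m" by simp
    then show ?thesis using False by (auto simp: layer_def)
  qed
  have R_meas: "R i \<in> sets borel" for i
  proof -
    have "(\<lambda>y. infdist y E) \<in> borel_measurable borel"
      by (intro borel_measurable_continuous_onI continuous_intros)
    then have "layer (fst i) \<in> sets borel" unfolding layer_def by measurable
    moreover have "range (cell (fst i)) \<subseteq> sets borel"
      unfolding cell_def by (intro sets.range_disjointed_sets) auto
    ultimately show ?thesis unfolding R_def by auto
  qed
  have disj: "disjoint_family R"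
    unfolding disjoint_family_on_def
  proof (intro ballI impI equals0I)
    fix i i' y assume "i \<noteq> i'" "y \<in> R i \<inter> R i'"
    then have y: "y \<in> cell (fst i) (snd i)" "y \<in> cell (fst i') (snd i')" "fst i = fst i'"
      by (auto simp: R_def layer_iff)
    then have "snd i = snd i'"
      using disjoint_family_disjointed[of "\<lambda>j. ball (\<nu> (fst i) j) (2 powr real_of_int (fst i))"]
      unfolding cell_def disjoint_family_on_def by (metis IntI UNIV_I empty_iff)
    then show False using \<open>i \<noteq> i'\<close> y(3) by (simp add: prod_eq_iff)
  qed
  have union: "(\<Union>i. R i) = {y. 0 < infdist y E}"
  proof (intro equalityI subsetI)
    fix y assume "y \<in> {y. 0 < infdist y E}"
    then have y: "y \<in> layer (\<lfloor>log 2 (infdist y E)\<rfloor> - 3)" (is "_ \<in> layer ?m") by (simp add: layer_iff)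
    have "y \<in> (\<Union>j. ball (\<nu> ?m j) (2 powr ?m))" using cover[of y ?m] by (auto simp: dist_commute)
    then have "y \<in> (\<Union>j. cell ?m j)" unfolding cell_def UN_disjointed_eq .
    then obtain j where "y \<in> cell ?m j" by auto
    with y have "y \<in> R (?m, j)" by (simp add: R_def)
    then show "y \<in> (\<Union>i. R i)" by blast
  qed (auto simp: R_def layer_iff)
  have close: "dist y (c i) < 2 powr real_of_int (fst i) \<and> 8 * 2 powr real_of_int (fst i) \<le> infdist y E \<and> infdist y E \<le> 16 * 2 powr real_of_int (fst i)"
    if "y \<in> R i" for y i
    using that disjointed_subset[of "\<lambda>j. ball (\<nu> (fst i) j) (2 powr real_of_int (fst i))" "snd i"]
    by (auto simp: R_def cell_def c_def layer_def dist_commute)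
  define b where "b i = ball (c i) (2 powr real_of_int (fst i) / 2)" for i
  have overlap: "(\<integral>\<^sup>+i. indicator {i. R i \<noteq> {} \<and> x \<in> b i} i \<partial>count_space UNIV) \<le> 3 * indicator (- E) x" for x
  proof -
    define J where "J = {i. R i \<noteq> {} \<and> x \<in> b i}"
    define L where "L = \<lfloor>log 2 (infdist x E)\<rfloor>"
    \<comment> \<open>\<open>x\<close> is within \<open>3/2\<close> of a scale from a point at distance between 8 and 16 scales from \<open>E\<close>.\<close>
    have range: "4 * 2 powr real_of_int (fst i) < infdist x E \<and> infdist x E < 32 * 2 powr real_of_int (fst i)" if "i \<in> J" for i
    proof -
      from that obtain y where "y \<in> R i" "x \<in> b i" by (auto simp: J_def)
      then have *: "dist y (c i) < 2 powr real_of_int (fst i)" "8 * 2 powr real_of_int (fst i) \<le> infdist y E"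
        "infdist y E \<le> 16 * 2 powr real_of_int (fst i)" "dist (c i) x < 2 powr real_of_int (fst i) / 2"
        using close by (auto simp: b_def)
      then have "dist x y < 3 / 2 * 2 powr real_of_int (fst i)"
        using dist_triangle[of x y "c i"] by (simp add: dist_commute)
      then show ?thesis
        using * infdist_triangle[of x E y] infdist_triangle[of y E x] by (simp add: dist_commute)
    qed
    have "fst ` J \<subseteq> {L - 4..L - 2}"
    proof safe
      fix m j assume "(m, j) \<in> J"
      then have r: "4 * 2 powr real_of_int m < infdist x E" "infdist x E < 32 * 2 powr real_of_int m" using range by force+
      have "0 < 4 * 2 powr real_of_int m" by simp
      then have pos: "0 < infdist x E" using r by linarith
      have "4 * 2 powr real_of_int m = 2 powr real_of_int (m + 2)" "32 * 2 powr real_of_int m = 2 powr real_of_int (m + 5)"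
        by (simp_all add: powr_add)
      then have "real_of_int (m + 2) < log 2 (infdist x E)" "log 2 (infdist x E) < real_of_int (m + 5)"
        using r pos by (simp_all only: less_log_iff log_less_iff)
      then show "fst (m, j) \<in> {L - 4..L - 2}" by (simp add: L_def) linarith
    qed
    moreover have "inj_on fst J"
    proof (rule inj_onI)
      fix i i' assume ii: "i \<in> J" "i' \<in> J" "fst i = fst i'"
      have near: "dist (c i) (c i') < 2 powr real_of_int (fst i)"
        using ii dist_triangle_half_r[of x "c i" "2 powr real_of_int (fst i)" "c i'"] by (simp add: J_def b_def dist_commute)
      have same: "\<nu> (fst i) (snd i) = \<nu> (fst i) (snd i')"
        using sep[of "fst i" "snd i" "snd i'"] near ii(3) by (auto simp: c_def)
      have "cell m j = {}" if "j' < j" "\<nu> m j = \<nu> m j'" for m j j'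
        using that by (auto simp: cell_def disjointed_def)
      moreover have "cell (fst i) (snd i) \<noteq> {}" "cell (fst i) (snd i') \<noteq> {}"
        using ii by (auto simp: J_def R_def)
      ultimately have "snd i = snd i'" using same by (metis linorder_neqE_nat)
      then show "i = i'" using ii(3) by (simp add: prod_eq_iff)
    qed
    ultimately have fin: "finite J" "card J \<le> 3"
      using inj_on_finite[of fst J "{L - 4..L - 2}"] card_inj_on_le[of fst J "{L - 4..L - 2}"] by auto
    have "(\<integral>\<^sup>+i. indicator J i \<partial>count_space UNIV) = of_nat (card J)"
      using fin by simp
    also have "\<dots> \<le> of_nat 3 * indicator (- E) x"
    proof (cases "J = {}")
      case False
      then obtain i where "i \<in> J" by auto
      then have "4 * 2 powr real_of_int (fst i) < infdist x E" using range by blast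
      moreover have "0 < 4 * 2 powr real_of_int (fst i)" by simp
      ultimately have "x \<notin> E" by auto
      then show ?thesis using fin(2) by (simp del: of_nat_numeral)
    qed simp
    finally show ?thesis by (simp add: J_def)
  qed
  have b_meas [measurable]: "b i \<in> sets borel" for i by (simp add: b_def)
  let ?h = "\<lambda>i x. indicator {i. R i \<noteq> {} \<and> x \<in> b i} i :: ennreal"
  have h: "?h i = (\<lambda>x. if R i = {} then 0 else indicator (b i) x)" for i
    by (auto simp: indicator_def fun_eq_iff)
  have "(\<integral>\<^sup>+i. (\<integral>\<^sup>+x. ?h i x \<partial>N) \<partial>count_space UNIV)
      = (\<integral>\<^sup>+x. (\<integral>\<^sup>+i. ?h i x \<partial>count_space UNIV) \<partial>N)"
  proof (rule nn_integral_count_space_nn_integral[symmetric])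
    show "?h i \<in> borel_measurable N" for i unfolding h by simp
  qed simp
  also have "\<dots> \<le> (\<integral>\<^sup>+x. 3 * indicator (- E) x \<partial>N)"
    by (intro nn_integral_mono overlap)
  also have "\<dots> = 3 * emeasure N (- E)"
    using E(2) by (intro nn_integral_cmult_indicator) auto
  finally have small_balls: "(\<integral>\<^sup>+i. (\<integral>\<^sup>+x. ?h i x \<partial>N) \<partial>count_space UNIV) \<le> 3 * emeasure N (- E)" .
  have "(\<integral>\<^sup>+i. (if R i = {} then 0 else emeasure N (ball (c i) (32 * 2 powr real_of_int (fst i)))) \<partial>count_space UNIV)
      \<le> (\<integral>\<^sup>+i. ennreal (C ^ 6) * (\<integral>\<^sup>+x. ?h i x \<partial>N) \<partial>count_space UNIV)"
  proof (rule nn_integral_mono)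
    fix i
    have "emeasure N (ball (c i) (32 * 2 powr real_of_int (fst i))) \<le> ennreal (C ^ 6) * emeasure N (b i)"
      unfolding b_def by (intro ball_compare) auto
    then show "(if R i = {} then 0 else emeasure N (ball (c i) (32 * 2 powr real_of_int (fst i))))
      \<le> ennreal (C ^ 6) * (\<integral>\<^sup>+x. ?h i x \<partial>N)"
      unfolding h by (simp add: b_meas)
  qed
  also have "\<dots> = ennreal (C ^ 6) * (\<integral>\<^sup>+i. (\<integral>\<^sup>+x. ?h i x \<partial>N) \<partial>count_space UNIV)"
    by (intro nn_integral_cmult) simp
  also have "\<dots> \<le> ennreal (C ^ 6) * (3 * emeasure N (- E))"
    by (intro mult_left_mono small_balls) simp
  also have "\<dots> = ennreal (3 * C ^ 6) * emeasure N (- E)"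
    using C_ge_1 by (simp add: ennreal_mult mult_ac)
  finally have total: "(\<integral>\<^sup>+i. (if R i = {} then 0 else emeasure N (ball (c i) (32 * 2 powr real_of_int (fst i)))) \<partial>count_space UNIV)
      \<le> ennreal (3 * C ^ 6) * emeasure N (- E)" .
  show ?thesis
    using R_meas disj union close total by (intro exI[of _ c] exI[of _ "\<lambda>i. 2 powr real_of_int (fst i)"] exI[of _ R]) auto
qed

text \<open>The conditions on the support are closed, so they survive the closure in \<open>half_supp\<close>. The radius
\<open>32 r\<close> leaves room: a point within \<open>r\<close> of the centre has distance at least \<open>31 r\<close> from the complement.\<close>

lemma half_supp_subset_tent:
  fixes a :: "'a::metric_space \<times> real \<Rightarrow> complex"
  assumes proper: "ball c (32 * r) \<noteq> UNIV"
    and supp: "\<And>y t. 0 < t \<Longrightarrow> a (y, t) \<noteq> 0 \<Longrightarrow> dist y c < r \<and> t \<le> 16 * r"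
  shows "half_supp a \<subseteq> tent (ball c (32 * r))"
proof -
  let ?K = "{z. dist (fst z) c \<le> r \<and> snd z \<le> 16 * r}"
  have "closed ?K"
    by (intro closed_Collect_conj closed_Collect_le continuous_intros)
  moreover have "{z \<in> UNIV \<times> {0<..}. a z \<noteq> 0} \<subseteq> ?K" using supp by force
  ultimately have sub: "closure {z \<in> UNIV \<times> {0<..}. a z \<noteq> 0} \<subseteq> ?K" by (rule closure_minimal[rotated])
  show ?thesis
  proof
    fix z assume "z \<in> half_supp a"
    then have z: "dist (fst z) c \<le> r" "snd z \<le> 16 * r" "0 < snd z"
      using sub by (auto simp: half_supp_def)
    have "16 * r \<le> infdist (fst z) (- ball c (32 * r))"
    proof (rule le_infdistI)
      show "- ball c (32 * r) \<noteq> {}" using proper by auto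
      fix x assume "x \<in> - ball c (32 * r)"
      then show "16 * r \<le> dist (fst z) x"
        using z dist_triangle[of c x "fst z"] by (simp add: dist_commute)
    qed
    then show "z \<in> tent (ball c (32 * r))" using z by (cases z) (simp add: tent_def)
  qed
qed

section \<open>Cone integrals under a second doubling measure\<close>

text \<open>Minkowski's inequality for countably many functions in \<open>L\<^sup>2\<close>: expand the square and apply the
Cauchy--Schwarz inequality to each mixed term.\<close>

lemma nn_integral_square_suminf_le:
  fixes g :: "nat \<Rightarrow> 'b \<Rightarrow> ennreal"
  assumes [measurable]: "\<And>j. g j \<in> borel_measurable \<nu>"
  shows "(\<integral>\<^sup>+z. (\<Sum>j. g j z)\<^sup>2 \<partial>\<nu>) \<le> (\<Sum>j. epowr (\<integral>\<^sup>+z. (g j z)\<^sup>2 \<partial>\<nu>) (1 / 2))\<^sup>2"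
proof -
  define \<alpha> where "\<alpha> j = epowr (\<integral>\<^sup>+z. (g j z)\<^sup>2 \<partial>\<nu>) (1 / 2)" for j
  have CS: "(\<integral>\<^sup>+z. g i z * g j z \<partial>\<nu>) \<le> \<alpha> i * \<alpha> j" for i j
  proof -
    have "epowr ((\<integral>\<^sup>+z. g i z * g j z \<partial>\<nu>)\<^sup>2) (1 / 2)
        \<le> epowr ((\<integral>\<^sup>+z. (g i z)\<^sup>2 \<partial>\<nu>) * (\<integral>\<^sup>+z. (g j z)\<^sup>2 \<partial>\<nu>)) (1 / 2)"
      by (intro epowr_mono Cauchy_Schwarz_nn_integral) simp_all
    then show ?thesis by (simp add: epowr_mult \<alpha>_def)
  qed
  have "(\<integral>\<^sup>+z. (\<Sum>j. g j z)\<^sup>2 \<partial>\<nu>) = (\<integral>\<^sup>+z. (\<Sum>i. \<Sum>j. g i z * g j z) \<partial>\<nu>)"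
    by (simp add: power2_eq_square)
  also have "\<dots> = (\<Sum>i. \<Sum>j. \<integral>\<^sup>+z. g i z * g j z \<partial>\<nu>)"
    by (simp add: nn_integral_suminf del: ennreal_suminf_cmult)
  also have "\<dots> \<le> (\<Sum>i. \<Sum>j. \<alpha> i * \<alpha> j)"
    by (intro suminf_le CS) auto
  also have "\<dots> = (\<Sum>j. \<alpha> j)\<^sup>2"
    by (simp add: power2_eq_square)
  finally show ?thesis by (simp add: \<alpha>_def)
qed

text \<open>\<open>M\<close> is the measure in the half space and in the volumes \<open>V(x,t)\<close>; \<open>W\<close> is the weighted measure with respect
to which the norms of square functions are taken.\<close>

locale doubling_pair = M: doubling M A + W: doubling W C
  for M W :: "'a::metric_space measure" and A C
begin

abbreviation "H \<equiv> half_space M"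

lemma kernel_measurable_z [measurable]: "cone_kernel M \<alpha> x \<in> borel_measurable H"
  using M.cone_kernel_measurable[of "\<lambda>_. x" H "\<lambda>z. z" \<alpha>] by simp

text \<open>Integrating \<open>S\<^sub>\<alpha> u\<close> against a function of \<open>x\<close> is integrating \<open>u\<close> against an average of that function over
the ball of all vertices whose cone contains \<open>z\<close>.\<close>

lemma tonelli:
  assumes u [measurable]: "u \<in> borel_measurable H" and g [measurable]: "g \<in> borel_measurable borel"
  shows "(\<integral>\<^sup>+x. g x * cone_int M \<alpha> u x \<partial>W)
     = (\<integral>\<^sup>+z. u z * (\<integral>\<^sup>+x. g x * cone_kernel M \<alpha> x z \<partial>W) \<partial>H)"
proof -
  interpret W: sigma_finite_measure W by (rule W.sigma_finite)
  interpret H: sigma_finite_measure H by (rule M.sigma_finite_half_space)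
  interpret pair_sigma_finite W H ..
  have gW [measurable]: "g \<in> borel_measurable W" using g by (simp add: measurable_cong_sets[OF W.sets_N refl])
  have [measurable]: "(\<lambda>p. cone_kernel M \<alpha> (fst p) (snd p)) \<in> borel_measurable (W \<Otimes>\<^sub>M H)"
    by (intro M.cone_kernel_measurable measurable_snd)
       (use measurable_fst[of W H] in \<open>simp add: measurable_cong_sets[OF refl W.sets_N]\<close>)
  have "(\<integral>\<^sup>+x. g x * cone_int M \<alpha> u x \<partial>W) = (\<integral>\<^sup>+x. \<integral>\<^sup>+z. g x * (u z * cone_kernel M \<alpha> x z) \<partial>H \<partial>W)"
    by (intro nn_integral_cong) (simp add: cone_int_def nn_integral_cmult)
  also have "\<dots> = (\<integral>\<^sup>+z. \<integral>\<^sup>+x. g x * (u z * cone_kernel M \<alpha> x z) \<partial>W \<partial>H)"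
    by (rule Fubini'[symmetric]) (simp add: case_prod_unfold)
  also have "\<dots> = (\<integral>\<^sup>+z. u z * (\<integral>\<^sup>+x. g x * cone_kernel M \<alpha> x z \<partial>W) \<partial>H)"
  proof (rule nn_integral_cong)
    fix z assume z: "z \<in> space H"
    have "(\<lambda>x. cone_kernel M \<alpha> x z) \<in> borel_measurable W"
      using z by (intro M.cone_kernel_measurable measurable_const) (simp add: measurable_cong_sets[OF W.sets_N refl])
    then have "(\<integral>\<^sup>+x. u z * (g x * cone_kernel M \<alpha> x z) \<partial>W) = u z * (\<integral>\<^sup>+x. g x * cone_kernel M \<alpha> x z \<partial>W)"
      by (intro nn_integral_cmult borel_measurable_times_ennreal gW)
    then show "(\<integral>\<^sup>+x. g x * (u z * cone_kernel M \<alpha> x z) \<partial>W) = u z * (\<integral>\<^sup>+x. g x * cone_kernel M \<alpha> x z \<partial>W)"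
      by (simp add: mult_ac)
  qed
  finally show ?thesis .
qed

lemma cone_kernel_pos: "0 < t \<Longrightarrow> dist x y < \<alpha> * t \<Longrightarrow> 0 < cone_kernel M \<alpha> x (y, t)"
  by (simp add: cone_kernel_def M.inverse_vol_pos)

text \<open>Every \<open>(y,t)\<close> lies in the cones at all \<open>x \<in> ball y t\<close>, a set of positive \<open>W\<close>-measure; so its total
weight in Tonelli's formula is positive.\<close>

lemma cone_int_0_imp:
  assumes u [measurable]: "u \<in> borel_measurable H" and 0: "AE x in W. cone_int M 1 u x = 0"
  shows "AE z in H. u z = 0"
proof -
  define k where "k z = (\<integral>\<^sup>+x. 1 * cone_kernel M 1 x z \<partial>W)" for z
  interpret W: sigma_finite_measure W by (rule W.sigma_finite)
  interpret H: sigma_finite_measure H by (rule M.sigma_finite_half_space)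
  have [measurable]: "k \<in> borel_measurable H"
  proof -
    have "(\<lambda>p. cone_kernel M 1 (snd p) (fst p)) \<in> borel_measurable (H \<Otimes>\<^sub>M W)"
      by (intro M.cone_kernel_measurable measurable_fst)
         (use measurable_snd[of H W] in \<open>simp add: measurable_cong_sets[OF refl W.sets_N]\<close>)
    then show ?thesis unfolding k_def mult_1 by (intro W.borel_measurable_nn_integral) (simp add: case_prod_unfold)
  qed
  have "(\<integral>\<^sup>+x. 1 * cone_int M 1 u x \<partial>W) = (\<integral>\<^sup>+x. 0 \<partial>W)"
    by (rule nn_integral_cong_AE) (use 0 in simp)
  then have "(\<integral>\<^sup>+z. u z * k z \<partial>H) = 0"
    unfolding k_def by (subst tonelli[symmetric]) auto
  then have "AE z in H. u z * k z = 0"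
    by (simp add: nn_integral_0_iff_AE)
  moreover have "k z \<noteq> 0" if z: "z \<in> space H" for z
  proof
    obtain y t where yt: "z = (y, t)" "0 < t" using z M.space_half_space by auto
    have meas: "(\<lambda>x. cone_kernel M 1 x z) \<in> borel_measurable W"
      using z by (intro M.cone_kernel_measurable measurable_const) (simp add: measurable_cong_sets[OF W.sets_N refl])
    assume "k z = 0"
    then have "AE x in W. cone_kernel M 1 x z = 0"
      using meas by (simp add: k_def nn_integral_0_iff_AE)
    then have "AE x in W. x \<notin> ball y t"
    proof eventually_elim
      fix x assume 0: "cone_kernel M 1 x z = 0"
      show "x \<notin> ball y t"
      proof
        assume "x \<in> ball y t"
        then have "0 < cone_kernel M 1 x z"
          unfolding yt(1) using yt(2) by (intro cone_kernel_pos) (simp_all add: dist_commute)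
        then show False using 0 by simp
      qed
    qed
    then have "emeasure W (ball y t) = 0"
      by (subst (asm) AE_iff_measurable[of "ball y t"]) auto
    then show False using W.ball_pos[OF yt(2), of y] by simp
  qed
  ultimately show ?thesis by (auto elim!: AE_mp intro!: AE_I2)
qed

text \<open>Apply the previous lemma to the indicator of \<open>{u = \<infinity>}\<close>: where the cone integral of \<open>u\<close> is finite,
that of the indicator vanishes.\<close>

lemma cone_int_finite_imp:
  assumes u [measurable]: "u \<in> borel_measurable H" and fin: "AE x in W. cone_int M 1 u x < \<infinity>"
  shows "AE z in H. u z < \<infinity>"
proof -
  let ?v = "\<lambda>z. indicator {\<infinity>} (u z) :: ennreal"
  have v: "?v \<in> borel_measurable H" by measurable
  have "AE x in W. cone_int M 1 ?v x = 0"
    using fin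
  proof eventually_elim
    fix x assume "cone_int M 1 u x < \<infinity>"
    moreover have "\<infinity> * cone_int M 1 ?v x = (\<integral>\<^sup>+z. \<infinity> * (?v z * cone_kernel M 1 x z) \<partial>H)"
      unfolding cone_int_def using v by (intro nn_integral_cmult[symmetric]) auto
    moreover have "\<dots> \<le> cone_int M 1 u x"
      unfolding cone_int_def mult.assoc[symmetric]
      by (intro nn_integral_mono mult_right_mono) (auto simp: indicator_def)
    ultimately have "\<infinity> * cone_int M 1 ?v x < \<infinity>" by (metis order_le_less_trans)
    then show "cone_int M 1 ?v x = 0" by (auto simp: ennreal_top_mult split: if_splits)
  qed
  from cone_int_0_imp[OF v this] show ?thesis
    by eventually_elim (auto simp: indicator_def less_top split: if_splits)
qed

section \<open>Sums of atoms\<close>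

text \<open>By Young's inequality \<open>s f\<^sup>p \<le> (p/q) (s f\<^sup>p)\<^bsup>q/p\<^esup> + (1 - p/q)\<close> on \<open>B\<close>, where \<open>s = W(B)\<close>; the normalisation of
atoms makes the integral of the right-hand side over \<open>B\<close> at most \<open>s\<close>.\<close>

lemma atom_Lp_le_1:
  assumes B [measurable]: "B \<in> sets borel" and s: "emeasure W B = ennreal s" "0 < s"
    and pq: "0 < p" "p < q"
    and f [measurable]: "f \<in> borel_measurable borel" and supp: "\<And>x. x \<notin> B \<Longrightarrow> f x = 0"
    and fq: "epowr (\<integral>\<^sup>+x. epowr (f x) q \<partial>W) (1 / q) \<le> epowr (emeasure W B) (1 / q - 1 / p)"
  shows "(\<integral>\<^sup>+x. epowr (f x) p \<partial>W) \<le> 1"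
proof -
  have q: "0 < q" using pq by simp
  define \<theta> where "\<theta> = p / q"
  have \<theta>: "0 < \<theta>" "\<theta> < 1" using pq q by (auto simp: \<theta>_def)
  have Iq: "(\<integral>\<^sup>+x. epowr (f x) q \<partial>W) \<le> ennreal (s powr (1 - q / p))"
  proof -
    have "epowr (epowr (\<integral>\<^sup>+x. epowr (f x) q \<partial>W) (1 / q)) q \<le> epowr (ennreal (s powr (1 / q - 1 / p))) q"
      using fq s q by (intro epowr_mono) (simp_all add: epowr_def[of "ennreal s"])
    moreover have "(1 / q - 1 / p) * q = 1 - q / p" using pq q by (simp add: field_simps)
    ultimately show ?thesis using q by (simp add: epowr_epowr epowr_ennreal powr_powr)
  qed
  have young: "ennreal s * epowr (f x) p
      \<le> ennreal (\<theta> * s powr (q / p)) * epowr (f x) q + ennreal (1 - \<theta>) * indicator B x" for x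
  proof (cases "x \<in> B")
    case True
    show ?thesis
    proof (cases "f x")
      case (real y)
      have "s * y powr p \<le> (\<theta> * s powr (q / p)) * y powr q + (1 - \<theta>)"
      proof (cases "y = 0")
        case False
        then have y: "0 < y" using real by simp
        have "(y powr q * s powr (q / p)) powr \<theta> * 1 powr (1 - \<theta>)
            \<le> \<theta> * (y powr q * s powr (q / p)) + (1 - \<theta>) * 1"
          using \<theta> y s by (intro Youngs_inequality_0) auto
        moreover have "(y powr q * s powr (q / p)) powr \<theta> = s * y powr p"
          using y s q pq by (simp add: powr_mult powr_powr \<theta>_def mult.commute)
        ultimately show ?thesis by (simp add: mult_ac)
      qed (use \<theta> in simp)
      then have "ennreal (s * y powr p) \<le> ennreal ((\<theta> * s powr (q / p)) * y powr q + (1 - \<theta>))"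
        by (rule ennreal_leI)
      then show ?thesis
        using real True s \<theta> pq q by (simp add: epowr_ennreal ennreal_mult ennreal_plus del: ennreal_plus[symmetric])
    next
      case top
      then show ?thesis using \<theta> s q by (simp add: ennreal_mult_top)
    qed
  qed (use supp pq in simp)
  have "ennreal s * (\<integral>\<^sup>+x. epowr (f x) p \<partial>W) = (\<integral>\<^sup>+x. ennreal s * epowr (f x) p \<partial>W)"
    by (intro nn_integral_cmult[symmetric]) measurable
  also have "\<dots> \<le> (\<integral>\<^sup>+x. ennreal (\<theta> * s powr (q / p)) * epowr (f x) q + ennreal (1 - \<theta>) * indicator B x \<partial>W)"
    by (intro nn_integral_mono young)
  also have "\<dots> = ennreal (\<theta> * s powr (q / p)) * (\<integral>\<^sup>+x. epowr (f x) q \<partial>W) + ennreal (1 - \<theta>) * emeasure W B"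
    by (simp add: nn_integral_add nn_integral_cmult nn_integral_cmult_indicator)
  also have "\<dots> \<le> ennreal (\<theta> * s powr (q / p)) * ennreal (s powr (1 - q / p)) + ennreal (1 - \<theta>) * emeasure W B"
    by (intro add_right_mono mult_left_mono Iq) simp
  also have "\<dots> = ennreal (\<theta> * (s powr (q / p) * s powr (1 - q / p)) + (1 - \<theta>) * s)"
    using s \<theta> by (simp add: ennreal_mult ennreal_plus mult.assoc del: ennreal_plus[symmetric])
  also have "s powr (q / p) * s powr (1 - q / p) = s"
    using s by (simp flip: powr_add)
  also have "\<theta> * s + (1 - \<theta>) * s = s" by (simp add: algebra_simps)
  finally have *: "ennreal s * (\<integral>\<^sup>+x. epowr (f x) p \<partial>W) \<le> ennreal s * 1" by simp
  then show ?thesis using s by (subst (asm) ennreal_mult_le_mult_iff) auto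
qed

text \<open>All estimates are made for the majorant \<open>u = (\<Sum> \<bar>\<lambda>\<^sub>j a\<^sub>j\<bar>)\<^sup>2\<close>, whose cone integral is finite almost
everywhere. This gives first the convergence of the series and then, by domination, the norm bound.\<close>

lemma synthesis:
  fixes lam :: "nat \<Rightarrow> complex" and a :: "nat \<Rightarrow> 'a \<times> real \<Rightarrow> complex"
  assumes a [measurable]: "\<And>j. a j \<in> borel_measurable H"
    and atom: "\<And>j. (\<integral>\<^sup>+x. epowr (sqfun M (a j) x) p \<partial>W) \<le> 1"
    and p: "0 < p" "p \<le> 1"
    and lam: "(\<Sum>j. ennreal (cmod (lam j) powr p)) < \<infinity>"
  defines "F \<equiv> \<lambda>z. \<Sum>j. lam j * a j z"
  shows "AE z in H. (\<lambda>j. lam j * a j z) sums F z"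
    and "(\<integral>\<^sup>+x. epowr (sqfun M F x) p \<partial>W) \<le> (\<Sum>j. ennreal (cmod (lam j) powr p))"
proof -
  define g where "g j z = ennreal (cmod (lam j * a j z))" for j z
  have g [measurable]: "g j \<in> borel_measurable H" for j unfolding g_def by measurable
  define u where "u z = (\<Sum>j. g j z)\<^sup>2" for z
  have u [measurable]: "u \<in> borel_measurable H" unfolding u_def by measurable
  have sq_meas: "sqfun M (a j) \<in> borel_measurable borel" for j
    unfolding sqfun_eq_cone_int[abs_def] by (intro epowr_measurable M.cone_int_measurable) measurable
  have minkowski: "epowr (cone_int M 1 u x) (1 / 2) \<le> (\<Sum>j. ennreal (cmod (lam j)) * sqfun M (a j) x)" for x
  proof -
    let ?\<nu> = "density H (cone_kernel M 1 x)"
    have *: "cone_int M 1 v x = (\<integral>\<^sup>+z. v z \<partial>?\<nu>)" if "v \<in> borel_measurable H" for v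
      unfolding cone_int_def using that by (subst nn_integral_density) (auto simp: mult.commute)
    have "epowr (cone_int M 1 u x) (1 / 2) \<le> epowr ((\<Sum>j. epowr (\<integral>\<^sup>+z. (g j z)\<^sup>2 \<partial>?\<nu>) (1 / 2))\<^sup>2) (1 / 2)"
      unfolding *[OF u] unfolding u_def by (intro epowr_mono nn_integral_square_suminf_le) simp_all
    also have "\<dots> = (\<Sum>j. epowr (cone_int M 1 (\<lambda>z. (g j z)\<^sup>2) x) (1 / 2))"
      by (simp add: *)
    also have "\<dots> = (\<Sum>j. ennreal (cmod (lam j)) * sqfun M (a j) x)"
    proof (rule suminf_cong)
      fix j
      have "cone_int M 1 (\<lambda>z. (g j z)\<^sup>2) x = (ennreal (cmod (lam j)))\<^sup>2 * cone_int M 1 (\<lambda>z. ennreal ((cmod (a j z))\<^sup>2)) x"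
        unfolding cone_int_def
        by (subst nn_integral_cmult[symmetric])
           (auto simp: g_def norm_mult ennreal_power ennreal_mult power_mult_distrib mult.assoc)
      then show "epowr (cone_int M 1 (\<lambda>z. (g j z)\<^sup>2) x) (1 / 2) = ennreal (cmod (lam j)) * sqfun M (a j) x"
        by (simp add: epowr_mult sqfun_eq_cone_int)
    qed
    finally show ?thesis .
  qed
  have bound: "(\<integral>\<^sup>+x. epowr (epowr (cone_int M 1 u x) (1 / 2)) p \<partial>W) \<le> (\<Sum>j. ennreal (cmod (lam j) powr p))"
  proof -
    have "(\<integral>\<^sup>+x. epowr (epowr (cone_int M 1 u x) (1 / 2)) p \<partial>W)
        \<le> (\<integral>\<^sup>+x. (\<Sum>j. ennreal (cmod (lam j) powr p) * epowr (sqfun M (a j) x) p) \<partial>W)"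
    proof (rule nn_integral_mono)
      fix x
      have "epowr (epowr (cone_int M 1 u x) (1 / 2)) p \<le> epowr (\<Sum>j. ennreal (cmod (lam j)) * sqfun M (a j) x) p"
        using p by (intro epowr_mono minkowski)
      also have "\<dots> \<le> (\<Sum>j. epowr (ennreal (cmod (lam j)) * sqfun M (a j) x) p)"
        using p by (rule epowr_suminf_le)
      finally show "epowr (epowr (cone_int M 1 u x) (1 / 2)) p
          \<le> (\<Sum>j. ennreal (cmod (lam j) powr p) * epowr (sqfun M (a j) x) p)"
        using p by (simp add: epowr_mult epowr_ennreal)
    qed
    also have "\<dots> = (\<Sum>j. ennreal (cmod (lam j) powr p) * (\<integral>\<^sup>+x. epowr (sqfun M (a j) x) p \<partial>W))"
    proof -
      have [measurable]: "(\<lambda>x. epowr (sqfun M (a j) x) p) \<in> borel_measurable W" for j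
        using epowr_measurable[OF sq_meas, of j p] by (simp add: measurable_cong_sets[OF W.sets_N refl])
      show ?thesis by (simp add: nn_integral_suminf nn_integral_cmult)
    qed
    also have "\<dots> \<le> (\<Sum>j. ennreal (cmod (lam j) powr p) * 1)"
      by (intro suminf_le mult_left_mono atom) auto
    finally show ?thesis by simp
  qed
  have "AE x in W. epowr (epowr (cone_int M 1 u x) (1 / 2)) p \<noteq> \<infinity>"
  proof (rule nn_integral_PInf_AE)
    show "(\<lambda>x. epowr (epowr (cone_int M 1 u x) (1 / 2)) p) \<in> borel_measurable W"
      using epowr_measurable[OF epowr_measurable[OF M.cone_int_measurable[OF u]], of 1 "1/2" p]
      by (simp add: measurable_cong_sets[OF W.sets_N refl])
    show "(\<integral>\<^sup>+x. epowr (epowr (cone_int M 1 u x) (1 / 2)) p \<partial>W) \<noteq> \<infinity>"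
      using bound lam by (auto simp: top_unique)
  qed
  then have "AE x in W. cone_int M 1 u x < \<infinity>"
  proof eventually_elim
    fix x assume "epowr (epowr (cone_int M 1 u x) (1 / 2)) p \<noteq> \<infinity>"
    then have "epowr (epowr (cone_int M 1 u x) (1 / 2)) p < top" by (simp add: less_top)
    then show "cone_int M 1 u x < \<infinity>" using p by (simp add: epowr_less_top_iff)
  qed
  then have "AE z in H. u z < \<infinity>" by (rule cone_int_finite_imp[OF u])
  then have fin: "AE z in H. (\<Sum>j. g j z) < \<infinity>"
    by eventually_elim (simp add: u_def power_less_top_ennreal)
  have summ: "summable (\<lambda>j. cmod (lam j * a j z))" if "(\<Sum>j. g j z) < \<infinity>" for z
    using that by (intro summable_suminf_not_top) (auto simp: g_def)
  show "AE z in H. (\<lambda>j. lam j * a j z) sums F z"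
    using fin
  proof eventually_elim
    fix z assume "(\<Sum>j. g j z) < \<infinity>"
    then have "summable (\<lambda>j. lam j * a j z)" by (rule summable_norm_cancel[OF summ])
    then show "(\<lambda>j. lam j * a j z) sums F z" by (simp add: F_def summable_sums)
  qed
  have "cone_int M 1 (\<lambda>z. ennreal ((cmod (F z))\<^sup>2)) x \<le> cone_int M 1 u x" for x
    unfolding cone_int_def
  proof (rule nn_integral_mono_AE, use fin in eventually_elim)
    fix z assume z: "(\<Sum>j. g j z) < \<infinity>"
    have "ennreal (cmod (F z)) \<le> ennreal (\<Sum>j. cmod (lam j * a j z))"
      unfolding F_def by (intro ennreal_leI summable_norm summ z)
    also have "\<dots> = (\<Sum>j. g j z)"
      unfolding g_def using summ[OF z] by (intro suminf_ennreal2[symmetric]) auto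
    finally have "(ennreal (cmod (F z)))\<^sup>2 \<le> u z" unfolding u_def by (intro power_mono) auto
    then show "ennreal ((cmod (F z))\<^sup>2) * cone_kernel M 1 x z \<le> u z * cone_kernel M 1 x z"
      by (intro mult_right_mono) (auto simp: ennreal_power)
  qed
  then have "(\<integral>\<^sup>+x. epowr (sqfun M F x) p \<partial>W) \<le> (\<integral>\<^sup>+x. epowr (epowr (cone_int M 1 u x) (1 / 2)) p \<partial>W)"
    unfolding sqfun_eq_cone_int using p by (intro nn_integral_mono epowr_mono) auto
  with bound show "(\<integral>\<^sup>+x. epowr (sqfun M F x) p \<partial>W) \<le> (\<Sum>j. ennreal (cmod (lam j) powr p))"
    by (rule order_trans[rotated])
qed

section \<open>Change of aperture\<close>

lemma space_half_space_iff: "z \<in> space H \<longleftrightarrow> 0 < snd z"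
  by (cases z) (simp add: M.space_half_space)

lemma W_measurable [simp]: "borel_measurable W = borel_measurable borel"
  by (simp add: measurable_cong_sets[OF W.sets_N refl])

lemma cone_int_cmult:
  assumes u [measurable]: "u \<in> borel_measurable H"
  shows "cone_int M \<alpha> (\<lambda>z. c * u z) x = c * cone_int M \<alpha> u x"
  unfolding cone_int_def mult.assoc by (rule nn_integral_cmult) measurable

text \<open>By Tonelli's theorem this is an inequality between averages at each \<open>(y,t)\<close>. If \<open>ball y (4t)\<close> lies
in \<open>Us\<close>, the left one vanishes. Otherwise half of the \<open>W\<close>-mass of \<open>ball y t\<close> lies outside \<open>U\<close>, and
doubling of \<open>W\<close> compares the balls of radius \<open>4t\<close> and \<open>t\<close>.\<close>

lemma aperture_off_maximal_set:
  assumes u [measurable]: "u \<in> borel_measurable H"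
    and U [measurable]: "U \<in> sets borel" "Us \<in> sets borel"
    and thick: "\<And>y t. 0 < t \<Longrightarrow> \<not> ball y (4 * t) \<subseteq> Us \<Longrightarrow> emeasure W (ball y t) \<le> 2 * emeasure W (ball y t - U)"
  shows "(\<integral>\<^sup>+x. indicator (- Us) x * cone_int M 4 u x \<partial>W)
     \<le> ennreal (2 * A ^ 4 * C\<^sup>2) * (\<integral>\<^sup>+x. indicator (- U) x * cone_int M 1 u x \<partial>W)"
proof -
  have kern: "(\<integral>\<^sup>+x. indicator (- Us) x * cone_kernel M 4 x z \<partial>W)
      \<le> ennreal (2 * A ^ 4 * C\<^sup>2) * (\<integral>\<^sup>+x. indicator (- U) x * cone_kernel M 1 x z \<partial>W)"
    if z: "z \<in> space H" for z
  proof -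
    obtain y t where yt: "z = (y, t)" "0 < t" using z M.space_half_space by auto
    define \<kappa> where "\<kappa> = inverse (vol M y t * ennreal t)"
    have km: "(\<lambda>x. cone_kernel M \<alpha> x z) \<in> borel_measurable borel" for \<alpha>
      using z by (intro M.cone_kernel_measurable measurable_const) auto
    show ?thesis
    proof (cases "ball y (4 * t) \<subseteq> Us")
      case True
      have "indicator (- Us) x * cone_kernel M 4 x z = 0" for x
        using True by (auto simp: indicator_def cone_kernel_def yt dist_commute subset_iff)
      then have "(\<integral>\<^sup>+x. indicator (- Us) x * cone_kernel M 4 x z \<partial>W) = (\<integral>\<^sup>+x. 0 \<partial>W)"
        by (intro nn_integral_cong)
      then show ?thesis by simp
    next
      case False
      define X where "X = (\<integral>\<^sup>+x. indicator (- U) x * cone_kernel M 1 x z \<partial>W)"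
      have lower: "\<kappa> * emeasure W (ball y t - U) \<le> ennreal A * X"
      proof -
        have "\<kappa> * emeasure W (ball y t - U) = (\<integral>\<^sup>+x. \<kappa> * indicator (ball y t - U) x \<partial>W)"
          by (rule nn_integral_cmult_indicator[symmetric]) simp
        also have "\<dots> \<le> (\<integral>\<^sup>+x. ennreal A * (indicator (- U) x * cone_kernel M 1 x z) \<partial>W)"
        proof (rule nn_integral_mono)
          fix x
          show "\<kappa> * indicator (ball y t - U) x \<le> ennreal A * (indicator (- U) x * cone_kernel M 1 x z)"
          proof (cases "x \<in> ball y t - U")
            case True
            then have "\<kappa> \<le> ennreal (A ^ 1) * inverse (vol M x t * ennreal t)"
              unfolding \<kappa>_def using yt by (intro M.inverse_vol_compare) auto
            then show ?thesis using True yt by (simp add: cone_kernel_def dist_commute)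
          qed simp
        qed
        also have "\<dots> = ennreal A * X"
          unfolding X_def using km by (intro nn_integral_cmult) simp
        finally show ?thesis .
      qed
      have "(\<integral>\<^sup>+x. indicator (- Us) x * cone_kernel M 4 x z \<partial>W)
          \<le> (\<integral>\<^sup>+x. (ennreal (A ^ 3) * \<kappa>) * indicator (ball y (4 * t)) x \<partial>W)"
      proof (rule nn_integral_mono)
        fix x
        show "indicator (- Us) x * cone_kernel M 4 x z \<le> (ennreal (A ^ 3) * \<kappa>) * indicator (ball y (4 * t)) x"
        proof (cases "dist x y < 4 * t")
          case True
          have "inverse (vol M x t * ennreal t) \<le> ennreal (A ^ 3) * \<kappa>"
            unfolding \<kappa>_def using True yt by (intro M.inverse_vol_compare) auto
          then show ?thesis using True yt by (auto simp: cone_kernel_def indicator_def dist_commute)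
        qed (simp add: cone_kernel_def yt indicator_def)
      qed
      also have "\<dots> = (ennreal (A ^ 3) * \<kappa>) * emeasure W (ball y (4 * t))"
        by (rule nn_integral_cmult_indicator) simp
      also have "\<dots> \<le> (ennreal (A ^ 3) * \<kappa>) * (ennreal (C\<^sup>2) * emeasure W (ball y t))"
        using yt by (intro mult_left_mono W.ball_compare) auto
      also have "\<dots> \<le> (ennreal (A ^ 3) * \<kappa>) * (ennreal (C\<^sup>2) * (2 * emeasure W (ball y t - U)))"
        using yt False by (intro mult_left_mono thick) auto
      also have "\<dots> = (ennreal (A ^ 3) * ennreal (C\<^sup>2) * 2) * (\<kappa> * emeasure W (ball y t - U))"
        by (simp only: mult_ac)
      also have "\<dots> \<le> (ennreal (A ^ 3) * ennreal (C\<^sup>2) * 2) * (ennreal A * X)"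
        by (intro mult_left_mono lower) simp
      also have "\<dots> = (2 * (ennreal (A ^ 3) * ennreal A) * ennreal (C\<^sup>2)) * X"
        by (simp only: mult_ac)
      also have "2 * (ennreal (A ^ 3) * ennreal A) * ennreal (C\<^sup>2) = ennreal (2 * (A ^ 3 * A) * C\<^sup>2)"
        using M.C_ge_1 W.C_ge_1 by (simp add: ennreal_mult)
      also have "A ^ 3 * A = A ^ 4" by (simp add: numeral_eq_Suc)
      finally show ?thesis by (simp add: X_def)
    qed
  qed
  have "(\<integral>\<^sup>+x. indicator (- Us) x * cone_int M 4 u x \<partial>W)
      = (\<integral>\<^sup>+z. u z * (\<integral>\<^sup>+x. indicator (- Us) x * cone_kernel M 4 x z \<partial>W) \<partial>H)"
    by (rule tonelli) simp_all
  also have "\<dots> \<le> (\<integral>\<^sup>+z. u z * (ennreal (2 * A ^ 4 * C\<^sup>2) * (\<integral>\<^sup>+x. indicator (- U) x * cone_kernel M 1 x z \<partial>W)) \<partial>H)"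
    by (intro nn_integral_mono mult_left_mono kern) simp_all
  also have "\<dots> = (\<integral>\<^sup>+z. (\<lambda>z. ennreal (2 * A ^ 4 * C\<^sup>2) * u z) z * (\<integral>\<^sup>+x. indicator (- U) x * cone_kernel M 1 x z \<partial>W) \<partial>H)"
    by (simp add: mult_ac)
  also have "\<dots> = (\<integral>\<^sup>+x. indicator (- U) x * cone_int M 1 (\<lambda>z. ennreal (2 * A ^ 4 * C\<^sup>2) * u z) x \<partial>W)"
    by (rule tonelli[symmetric]) simp_all
  also have "\<dots> = (\<integral>\<^sup>+x. ennreal (2 * A ^ 4 * C\<^sup>2) * (indicator (- U) x * cone_int M 1 u x) \<partial>W)"
    by (intro nn_integral_cong) (simp only: cone_int_cmult[OF u] mult.left_commute)
  also have "\<dots> = ennreal (2 * A ^ 4 * C\<^sup>2) * (\<integral>\<^sup>+x. indicator (- U) x * cone_int M 1 u x \<partial>W)"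
    using M.cone_int_measurable[OF u] by (intro nn_integral_cmult) simp
  finally show ?thesis .
qed

definition "aperture_const = 2 * C ^ 5 + 2 * A ^ 4 * C\<^sup>2"

lemma aperture_const_bounds: "2 * C ^ 5 \<le> aperture_const" "2 * A ^ 4 * C\<^sup>2 \<le> aperture_const" "0 < aperture_const"
  using M.C_ge_1 W.C_ge_1 by (auto simp: aperture_const_def intro!: add_pos_nonneg)

text \<open>Split the set on the left by the maximal set of \<open>U = {S\<^sub>1 > l}\<close>: the first part is controlled by \<open>W(U)\<close>,
the second by Markov's inequality for \<open>S\<^sub>4\<close> off the maximal set.\<close>

lemma aperture_level:
  assumes u [measurable]: "u \<in> borel_measurable H" and l: "0 < l"
  shows "emeasure W {x. ennreal l < cone_int M 4 u x}
    \<le> ennreal aperture_const * (emeasure W {x. ennreal l < cone_int M 1 u x}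
        + ennreal (1 / l) * (\<integral>\<^sup>+x. indicator {x. cone_int M 1 u x \<le> ennreal l} x * cone_int M 1 u x \<partial>W))"
proof -
  note [measurable] = M.cone_int_measurable[OF u]
  define U where "U = {x. ennreal l < cone_int M 1 u x}"
  have U [measurable]: "U \<in> sets borel" unfolding U_def by measurable
  have cU: "- U = {x. cone_int M 1 u x \<le> ennreal l}" by (auto simp: U_def)
  obtain Us where Us [measurable]: "Us \<in> sets borel" and small: "emeasure W Us \<le> ennreal (2 * C ^ 5) * emeasure W U"
    and thick: "\<And>y t. 0 < t \<Longrightarrow> \<not> ball y (4 * t) \<subseteq> Us \<Longrightarrow> emeasure W (ball y t) \<le> 2 * emeasure W (ball y t - U)"
    using W.maximal_set[OF U] by blast
  let ?O4 = "{x. ennreal l < cone_int M 4 u x}"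
  have O4 [measurable]: "?O4 \<in> sets borel" by measurable
  have "ennreal l * emeasure W (?O4 - Us) = (\<integral>\<^sup>+x. ennreal l * indicator (?O4 - Us) x \<partial>W)"
    by (rule nn_integral_cmult_indicator[symmetric]) simp
  also have "\<dots> \<le> (\<integral>\<^sup>+x. indicator (- Us) x * cone_int M 4 u x \<partial>W)"
    by (intro nn_integral_mono) (auto simp: indicator_def)
  also have "\<dots> \<le> ennreal (2 * A ^ 4 * C\<^sup>2) * (\<integral>\<^sup>+x. indicator (- U) x * cone_int M 1 u x \<partial>W)"
    by (rule aperture_off_maximal_set[OF u U Us thick])
  finally have *: "ennreal (1 / l) * (ennreal l * emeasure W (?O4 - Us))
     \<le> ennreal (1 / l) * (ennreal (2 * A ^ 4 * C\<^sup>2) * (\<integral>\<^sup>+x. indicator (- U) x * cone_int M 1 u x \<partial>W))"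
    by (rule mult_left_mono) simp
  then have off: "emeasure W (?O4 - Us)
     \<le> ennreal (2 * A ^ 4 * C\<^sup>2) * (ennreal (1 / l) * (\<integral>\<^sup>+x. indicator (- U) x * cone_int M 1 u x \<partial>W))"
  proof -
    have "ennreal (1 / l) * ennreal l = 1" using l by (simp flip: ennreal_mult)
    then have "ennreal (1 / l) * (ennreal l * y) = y" for y by (simp flip: mult.assoc)
    then show ?thesis using * by (simp only: mult.left_commute)
  qed
  have "emeasure W ?O4 \<le> emeasure W (Us \<union> (?O4 - Us))"
    by (intro emeasure_mono) auto
  also have "\<dots> \<le> emeasure W Us + emeasure W (?O4 - Us)"
    by (intro emeasure_subadditive) auto
  also have "\<dots> \<le> ennreal aperture_const * emeasure W U
      + ennreal aperture_const * (ennreal (1 / l) * (\<integral>\<^sup>+x. indicator (- U) x * cone_int M 1 u x \<partial>W))"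
    using aperture_const_bounds
    by (intro add_mono order_trans[OF small] order_trans[OF off] mult_right_mono ennreal_leI) auto
  finally show ?thesis unfolding cU[symmetric] U_def[symmetric] distrib_left .
qed

definition "layer_const P = aperture_const * (1 / (1 - 4 powr - P) + 1 / (1 - 4 powr - (1 - P)))"

text \<open>A discrete form of \<open>\<parallel>S\<^sub>4 u\<parallel>\<^sub>P \<lesssim> \<parallel>S\<^sub>1 u\<parallel>\<^sub>P\<close>: sum the estimate on the level \<open>l = 4\<^sup>k\<close> over all integers \<open>k\<close>
and interchange sum and integral. Both geometric series contribute a multiple of \<open>(S\<^sub>1 u)\<^sup>P\<close>.\<close>

lemma aperture_sum:
  assumes u [measurable]: "u \<in> borel_measurable H" and P: "0 < P" "P < 1"
  shows "(\<integral>\<^sup>+k. ennreal (4 powr (P * real_of_int k)) * emeasure W {x. ennreal (4 powr real_of_int k) < cone_int M 4 u x}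
          \<partial>count_space UNIV)
     \<le> ennreal (layer_const P) * (\<integral>\<^sup>+x. epowr (cone_int M 1 u x) P \<partial>W)"
proof -
  note [measurable] = M.cone_int_measurable[OF u]
  define s where "s = cone_int M 1 u"
  have s [measurable]: "s \<in> borel_measurable borel" unfolding s_def by measurable
  have lt: "4 powr - P < (1::real)" "4 powr - (1 - P) < (1::real)"
    using P powr_less_mono[of "-P" 0 4] powr_less_mono[of "-(1-P)" 0 4] by auto
  define h where "h k x = ennreal (4 powr (P * real_of_int k)) * indicator {k. ennreal (4 powr real_of_int k) < s x} k
     + ennreal (4 powr (- (1 - P) * real_of_int k)) * indicator {k. s x \<le> ennreal (4 powr real_of_int k)} k * s x"
    for k :: int and x
  have h_meas: "h k \<in> borel_measurable borel" for k
  proof -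
    have "h k = (\<lambda>x. ennreal (4 powr (P * real_of_int k)) * indicator {x. ennreal (4 powr real_of_int k) < s x} x
     + ennreal (4 powr (- (1 - P) * real_of_int k)) * indicator {x. s x \<le> ennreal (4 powr real_of_int k)} x * s x)"
      by (auto simp: h_def indicator_def fun_eq_iff)
    then show ?thesis by simp
  qed
  \<comment> \<open>The estimate of \<open>aperture_level\<close> with \<open>l = 4\<^sup>k\<close>, multiplied by \<open>4\<^bsup>Pk\<^esup>\<close> and read as one integral over \<open>W\<close>.\<close>
  have level: "ennreal (4 powr (P * real_of_int k)) * emeasure W {x. ennreal (4 powr real_of_int k) < cone_int M 4 u x}
     \<le> ennreal aperture_const * (\<integral>\<^sup>+x. h k x \<partial>W)" for k
  proof -
    let ?l = "4 powr real_of_int k"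
    have "ennreal (4 powr (P * real_of_int k)) * emeasure W {x. ennreal ?l < cone_int M 4 u x}
       \<le> ennreal (4 powr (P * real_of_int k)) * (ennreal aperture_const * (emeasure W {x. ennreal ?l < s x}
        + ennreal (1 / ?l) * (\<integral>\<^sup>+x. indicator {x. s x \<le> ennreal ?l} x * s x \<partial>W)))"
      unfolding s_def by (intro mult_left_mono aperture_level u) auto
    also have "\<dots> = ennreal aperture_const * (ennreal (4 powr (P * real_of_int k)) * emeasure W {x. ennreal ?l < s x}
        + ennreal (4 powr (P * real_of_int k) * (1 / ?l)) * (\<integral>\<^sup>+x. indicator {x. s x \<le> ennreal ?l} x * s x \<partial>W))"
    proof -
      have "ennreal (4 powr (P * real_of_int k) * (1 / ?l)) = ennreal (4 powr (P * real_of_int k)) * ennreal (1 / ?l)"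
        by (rule ennreal_mult) auto
      then show ?thesis by (simp only: distrib_left mult_ac)
    qed
    also have "4 powr (P * real_of_int k) * (1 / ?l) = 4 powr (- (1 - P) * real_of_int k)"
      by (simp add: powr_diff[symmetric] algebra_simps)
    also have "ennreal (4 powr (P * real_of_int k)) * emeasure W {x. ennreal ?l < s x}
        + ennreal (4 powr (- (1 - P) * real_of_int k)) * (\<integral>\<^sup>+x. indicator {x. s x \<le> ennreal ?l} x * s x \<partial>W)
        = (\<integral>\<^sup>+x. ennreal (4 powr (P * real_of_int k)) * indicator {x. ennreal ?l < s x} x
          + ennreal (4 powr (- (1 - P) * real_of_int k)) * (indicator {x. s x \<le> ennreal ?l} x * s x) \<partial>W)"
      by (subst nn_integral_add) (simp_all add: nn_integral_cmult nn_integral_cmult_indicator)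
    also have "\<dots> = (\<integral>\<^sup>+x. h k x \<partial>W)"
      by (intro nn_integral_cong) (auto simp: h_def indicator_def)
    finally show ?thesis .
  qed
  have inner: "(\<integral>\<^sup>+k. h k x \<partial>count_space UNIV)
      \<le> ennreal (1 / (1 - 4 powr - P) + 1 / (1 - 4 powr - (1 - P))) * epowr (s x) P" for x
  proof -
    have "(\<integral>\<^sup>+k. h k x \<partial>count_space UNIV) =
      (\<integral>\<^sup>+k. ennreal (4 powr (P * real_of_int k)) * indicator {k. ennreal (4 powr real_of_int k) < s x} k \<partial>count_space UNIV)
     + (\<integral>\<^sup>+k. ennreal (4 powr (- (1 - P) * real_of_int k)) * indicator {k. s x \<le> ennreal (4 powr real_of_int k)} k \<partial>count_space UNIV) * s x"
      unfolding h_def by (simp add: nn_integral_add nn_integral_multc)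
    also have "\<dots> \<le> ennreal (1 / (1 - 4 powr - P)) * epowr (s x) P
        + ennreal (1 / (1 - 4 powr - (1 - P))) * epowr (s x) (1 - (1 - P))"
      using P by (intro add_mono geometric_sum_below geometric_sum_above) auto
    finally show ?thesis
      using lt by (simp add: distrib_right)
  qed
  have "(\<integral>\<^sup>+k. ennreal (4 powr (P * real_of_int k)) * emeasure W {x. ennreal (4 powr real_of_int k) < cone_int M 4 u x}
          \<partial>count_space UNIV) \<le> (\<integral>\<^sup>+k. ennreal aperture_const * (\<integral>\<^sup>+x. h k x \<partial>W) \<partial>count_space UNIV)"
    by (intro nn_integral_mono level)
  also have "\<dots> = ennreal aperture_const * (\<integral>\<^sup>+k. (\<integral>\<^sup>+x. h k x \<partial>W) \<partial>count_space UNIV)"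
    by (intro nn_integral_cmult) simp
  also have "(\<integral>\<^sup>+k. (\<integral>\<^sup>+x. h k x \<partial>W) \<partial>count_space UNIV) = (\<integral>\<^sup>+x. (\<integral>\<^sup>+k. h k x \<partial>count_space UNIV) \<partial>W)"
    using h_meas by (intro nn_integral_count_space_nn_integral[symmetric]) simp_all
  also have "\<dots> \<le> (\<integral>\<^sup>+x. ennreal (1 / (1 - 4 powr - P) + 1 / (1 - 4 powr - (1 - P))) * epowr (s x) P \<partial>W)"
    by (intro nn_integral_mono inner)
  also have "\<dots> = ennreal (1 / (1 - 4 powr - P) + 1 / (1 - 4 powr - (1 - P))) * (\<integral>\<^sup>+x. epowr (s x) P \<partial>W)"
    by (intro nn_integral_cmult) (simp add: epowr_measurable)
  finally show ?thesis
    unfolding layer_const_def s_def using aperture_const_bounds lt by (simp add: ennreal_mult mult.assoc mult_left_mono)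
qed

section \<open>Cone integrals supported outside a tent\<close>

text \<open>If \<open>v(y,t) \<noteq> 0\<close> and \<open>d(x,y) < t\<close>, then \<open>x\<close> has distance less than \<open>2t\<close> from \<open>E\<close>. So one point \<open>x' \<in> E\<close>,
almost nearest to \<open>x\<close>, satisfies \<open>d(x',y) < 4t\<close> for all these \<open>(y,t)\<close> simultaneously. As the infimum
of the distances need not be attained, \<open>x'\<close> is chosen with an error \<open>\<epsilon>\<close> for
the part \<open>t \<ge> \<epsilon>\<close> of the cone, and \<open>\<epsilon>\<close> tends to 0.\<close>

lemma cone_int_le_of_level:
  assumes u [measurable]: "u \<in> borel_measurable H" and v [measurable]: "v \<in> borel_measurable H"
    and E: "E \<noteq> {}" "\<And>x. x \<in> E \<Longrightarrow> cone_int M 4 u x \<le> \<Lambda>"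
    and vu: "\<And>z. v z \<le> u z"
    and supp: "\<And>y t. 0 < t \<Longrightarrow> t \<le> infdist y E \<Longrightarrow> v (y, t) = 0"
  shows "cone_int M 1 v x \<le> ennreal (A\<^sup>2) * \<Lambda>"
proof -
  define f where "f n z = v z * indicator {z. 1 / real (Suc n) \<le> snd z} z * cone_kernel M 1 x z" for n z
  note M.snd_half_space [measurable]
  have f [measurable]: "f n \<in> borel_measurable H" for n unfolding f_def by measurable
  have bound: "(\<integral>\<^sup>+z. f n z \<partial>H) \<le> ennreal (A\<^sup>2) * \<Lambda>" for n
  proof -
    define \<epsilon> where "\<epsilon> = 1 / real (Suc n)"
    have \<epsilon>: "\<epsilon> > 0" by (simp add: \<epsilon>_def)
    obtain x' where x': "x' \<in> E" "dist x x' < infdist x E + \<epsilon>"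
      using infdist_lessE[OF E(1), of x "infdist x E + \<epsilon>"] \<epsilon> by auto
    have "(\<integral>\<^sup>+z. f n z \<partial>H) \<le> (\<integral>\<^sup>+z. ennreal (A\<^sup>2) * (u z * cone_kernel M 4 x' z) \<partial>H)"
    proof (rule nn_integral_mono)
      fix z assume "z \<in> space H"
      then obtain y t where z: "z = (y, t)" "0 < t" using M.space_half_space by auto
      show "f n z \<le> ennreal (A\<^sup>2) * (u z * cone_kernel M 4 x' z)"
      proof (cases "f n z = 0")
        case False
        then have t: "\<epsilon> \<le> t" and xy: "dist x y < t" and vz: "v (y, t) \<noteq> 0"
          by (auto simp: f_def z \<epsilon>_def cone_kernel_def indicator_def split: if_splits)
        have "infdist y E < t" using supp[of t y] vz z(2) by force
        then have "dist x x' < 3 * t"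
          using x' t xy infdist_triangle[of x E y] by linarith
        then have near: "dist x' y < 4 * t" and cmp: "t + dist x' x \<le> 2\<^sup>2 * t" "t + dist x x' \<le> 2\<^sup>2 * t"
          using xy dist_triangle[of x' y x] by (auto simp: dist_commute)
        have "f n z = v z * inverse (vol M x t * ennreal t)"
          using t xy z by (simp add: f_def \<epsilon>_def cone_kernel_def)
        also have "\<dots> \<le> u z * (ennreal (A\<^sup>2) * inverse (vol M x' t * ennreal t))"
          using z cmp by (intro mult_mono vu M.inverse_vol_compare) auto
        finally show ?thesis
          using z near by (simp add: cone_kernel_def mult_ac)
      qed simp
    qed
    also have "\<dots> = ennreal (A\<^sup>2) * cone_int M 4 u x'"
      unfolding cone_int_def by (intro nn_integral_cmult) measurable
    also have "\<dots> \<le> ennreal (A\<^sup>2) * \<Lambda>"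
      by (intro mult_left_mono E x') auto
    finally show ?thesis .
  qed
  have "cone_int M 1 v x \<le> (\<integral>\<^sup>+z. (SUP n. f n z) \<partial>H)"
    unfolding cone_int_def
  proof (rule nn_integral_mono)
    fix z assume "z \<in> space H"
    then have "0 < snd z" by (simp add: space_half_space_iff)
    then obtain n where "1 / real (Suc n) < snd z" by (metis nat_approx_posE)
    then have "v z * cone_kernel M 1 x z = f n z" by (simp add: f_def)
    then show "v z * cone_kernel M 1 x z \<le> (SUP n. f n z)" by (auto intro: SUP_upper2)
  qed
  also have "\<dots> = (SUP n. \<integral>\<^sup>+z. f n z \<partial>H)"
  proof (rule nn_integral_monotone_convergence_SUP[OF _ f])
    have "1 / real (Suc n) \<le> 1 / real (Suc m)" if "m \<le> n" for m n
      using that by (simp add: field_simps)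
    then show "incseq f"
      unfolding incseq_def le_fun_def f_def
      by (intro allI impI mult_right_mono mult_left_mono) (auto simp: indicator_def intro: order_trans)
  qed
  also have "\<dots> \<le> ennreal (A\<^sup>2) * \<Lambda>"
    by (intro SUP_least bound)
  finally show ?thesis .
qed

section \<open>The atomic decomposition\<close>

text \<open>A bound \<open>W(B)\<^bsup>-1/p\<^esup>\<close> on the square function and support in \<open>B\<close> make an atom for every \<open>q\<close>.\<close>

lemma bounded_imp_Lq:
  assumes B [measurable]: "B \<in> sets borel" and s: "emeasure W B = ennreal s" "0 < s" and q: "0 < q"
    and supp: "\<And>x. x \<notin> B \<Longrightarrow> f x = 0" and bd: "\<And>x. f x \<le> ennreal (s powr (- 1 / p))"
  shows "epowr (\<integral>\<^sup>+x. epowr (f x) q \<partial>W) (1 / q) \<le> epowr (emeasure W B) (1 / q - 1 / p)"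
proof -
  have "(\<integral>\<^sup>+x. epowr (f x) q \<partial>W) \<le> (\<integral>\<^sup>+x. ennreal (s powr (- q / p)) * indicator B x \<partial>W)"
  proof (rule nn_integral_mono)
    fix x
    have "epowr (f x) q \<le> epowr (ennreal (s powr (- 1 / p))) q"
      by (intro epowr_mono bd q)
    also have "\<dots> = ennreal (s powr (- q / p))" using q by (simp add: epowr_ennreal powr_powr)
    finally show "epowr (f x) q \<le> ennreal (s powr (- q / p)) * indicator B x"
      using supp[of x] q by (cases "x \<in> B") auto
  qed
  also have "\<dots> = ennreal (s powr (- q / p)) * emeasure W B"
    by (rule nn_integral_cmult_indicator) simp
  also have "\<dots> = ennreal (s powr (- q / p + 1))"
    using s by (simp add: powr_diff powr_minus divide_inverse mult.commute flip: ennreal_mult)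
  finally have "epowr (\<integral>\<^sup>+x. epowr (f x) q \<partial>W) (1 / q) \<le> epowr (ennreal (s powr (- q / p + 1))) (1 / q)"
    using q by (intro epowr_mono) auto
  also have "\<dots> = ennreal (s powr (1 / q - 1 / p))"
    using q by (simp add: epowr_ennreal powr_powr algebra_simps)
  finally show ?thesis using s by (simp add: epowr_def[of "ennreal s"])
qed

definition "decomposition_const p = (2 * A) powr p * (3 * C ^ 6 * layer_const (p / 2))"

text \<open>The pieces are indexed by a level \<open>k\<close> and a Whitney ball of \<open>O\<^sub>k\<close>; here \<open>E k\<close> is the complement
of \<open>O\<^sub>k\<close>, and \<open>Q k i\<close> consists of the points of the tent over \<open>O\<^sub>k\<close>, but not over \<open>O\<^bsub>k+1\<^esub>\<close>, whose
first coordinate lies in the \<open>i\<close>-th Whitney cell. The sets \<open>Q k i\<close> are disjoint, so at each point the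
series has at most one nonzero term. Points in no \<open>Q k i\<close> lie outside all tents, since \<open>W(O\<^sub>k)\<close> tends
to 0 for \<open>k \<rightarrow> \<infinity>\<close>; there \<open>F\<close> vanishes almost everywhere by \<open>cone_int_le_of_level\<close> with \<open>k \<rightarrow> -\<infinity>\<close>.\<close>

lemma decomposition:
  fixes F :: "'a \<times> real \<Rightarrow> complex"
  assumes W_inf: "emeasure W UNIV = \<infinity>"
    and F [measurable]: "F \<in> borel_measurable H"
    and p: "0 < p" "p \<le> 1" and q: "0 < q"
    and fin: "(\<integral>\<^sup>+x. epowr (sqfun M F x) p \<partial>W) < \<infinity>"
  shows "\<exists>(lam :: nat \<Rightarrow> complex) (a :: nat \<Rightarrow> 'a \<times> real \<Rightarrow> complex).
     (\<forall>j. a j \<in> borel_measurable H \<and>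
        (\<exists>c \<rho>. \<rho> > 0 \<and> half_supp (a j) \<subseteq> tent (ball c \<rho>) \<and>
           epowr (\<integral>\<^sup>+x. epowr (sqfun M (a j) x) q \<partial>W) (1 / q) \<le> epowr (emeasure W (ball c \<rho>)) (1 / q - 1 / p))) \<and>
     (AE z in H. (\<lambda>j. lam j * a j z) sums F z) \<and>
     (\<Sum>j. ennreal (cmod (lam j) powr p))
        \<le> ennreal (decomposition_const p) * (\<integral>\<^sup>+x. epowr (sqfun M F x) p \<partial>W)"
proof -
  note M.fst_half_space [measurable] M.snd_half_space [measurable]
  define P where "P = p / 2"
  have P: "0 < P" "P < 1" using p by (auto simp: P_def)
  define u where "u z = ennreal ((cmod (F z))\<^sup>2)" for z
  have u [measurable]: "u \<in> borel_measurable H" unfolding u_def by measurable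
  note [measurable] = M.cone_int_measurable[OF u]
  define I where "I = (\<integral>\<^sup>+x. epowr (cone_int M 1 u x) P \<partial>W)"
  have I: "(\<integral>\<^sup>+x. epowr (sqfun M F x) p \<partial>W) = I"
    using p by (simp add: I_def u_def[abs_def] sqfun_eq_cone_int epowr_epowr P_def)
  have I_fin: "I < \<infinity>" using fin I by simp
  define E where "E k = {x. cone_int M 4 u x \<le> ennreal (4 powr real_of_int k)}" for k
  have E_meas [measurable]: "E k \<in> sets borel" for k unfolding E_def by measurable
  have E_compl: "- E k = {x. ennreal (4 powr real_of_int k) < cone_int M 4 u x}" for k
    by (auto simp: E_def)
  have E_mono: "E k \<subseteq> E k'" if "k \<le> k'" for k k'
  proof -
    have "ennreal (4 powr real_of_int k) \<le> ennreal (4 powr real_of_int k')"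
      using that by (intro ennreal_leI powr_mono) auto
    then show ?thesis by (auto simp: E_def intro: order_trans)
  qed
  have layers: "(\<integral>\<^sup>+k. ennreal (4 powr (P * real_of_int k)) * emeasure W (- E k) \<partial>count_space UNIV)
      \<le> ennreal (layer_const P) * I"
    unfolding I_def E_compl by (rule aperture_sum[OF u P])
  have layer: "ennreal (4 powr (P * real_of_int k)) * emeasure W (- E k) \<le> ennreal (layer_const P) * I" for k
  proof -
    have "ennreal (4 powr (P * real_of_int k)) * emeasure W (- E k)
        \<le> (\<integral>\<^sup>+k. ennreal (4 powr (P * real_of_int k)) * emeasure W (- E k) \<partial>count_space UNIV)"
      by (rule nn_integral_ge_point) simp
    then show ?thesis using layers by (rule order_trans)
  qed
  have total_fin: "ennreal (layer_const P) * I < \<infinity>" using I_fin by (simp add: ennreal_mult_less_top)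
  have E_ne: "E k \<noteq> {}" for k
  proof
    assume "E k = {}"
    then have "ennreal (4 powr (P * real_of_int k)) * \<infinity> \<le> ennreal (layer_const P) * I"
      using layer[of k] W_inf by simp
    then show False using total_fin by (simp add: ennreal_mult_top top_unique)
  qed
  define is_whitney where "is_whitney k (c :: int \<times> nat \<Rightarrow> 'a) r R \<longleftrightarrow> (\<forall>i. 0 < r i) \<and>
     (\<forall>i. R i \<in> sets borel) \<and> disjoint_family R \<and> (\<Union>i. R i) = {y. 0 < infdist y (E k)} \<and>
     (\<forall>i. \<forall>y\<in>R i. dist y (c i) < r i \<and> infdist y (E k) \<le> 16 * r i) \<and>
     (\<integral>\<^sup>+i. (if R i = {} then 0 else emeasure W (ball (c i) (32 * r i))) \<partial>count_space UNIV)
        \<le> ennreal (3 * C ^ 6) * emeasure W (- E k)" for k c r R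
  have "\<exists>c r R. is_whitney k c r R" for k
    unfolding is_whitney_def by (rule W.whitney[OF E_ne E_meas])
  then obtain c r R where Wh: "\<And>k. is_whitney k (c k) (r k) (R k)" by metis
  have r_pos: "0 < r k i" and R_meas [measurable]: "R k i \<in> sets borel" and R_disj: "disjoint_family (R k)"
    and R_union: "(\<Union>i. R k i) = {y. 0 < infdist y (E k)}"
    and R_close: "y \<in> R k i \<Longrightarrow> dist y (c k i) < r k i \<and> infdist y (E k) \<le> 16 * r k i"
    and R_sum: "(\<integral>\<^sup>+i. (if R k i = {} then 0 else emeasure W (ball (c k i) (32 * r k i))) \<partial>count_space UNIV)
        \<le> ennreal (3 * C ^ 6) * emeasure W (- E k)" for k i y
    using Wh[of k] unfolding is_whitney_def by blast+
  define B where "B k i = ball (c k i) (32 * r k i)" for k i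
  have "\<exists>s>0. emeasure W (B k i) = ennreal s" for k i
    unfolding B_def using W.ball_real[of "32 * r k i" "c k i"] r_pos[of k i] by (metis mult_pos_pos zero_less_numeral)
  then obtain s where s: "\<And>k i. 0 < s k i" "\<And>k i. emeasure W (B k i) = ennreal (s k i)" by metis
  have ball_proper: "ball x \<rho> \<noteq> UNIV" for x :: 'a and \<rho>
    using W.finite_ball[of x \<rho>] W_inf by auto
  define Q where "Q k i = {z. 0 < snd z \<and> snd z \<le> infdist (fst z) (E k)
      \<and> infdist (fst z) (E (k + 1)) < snd z \<and> fst z \<in> R k i}" for k i
  have infdist_meas: "(\<lambda>z. infdist (fst z) (E k)) \<in> borel_measurable H" for k
    by (rule measurable_compose[OF M.fst_half_space])
       (intro borel_measurable_continuous_onI continuous_intros)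
  have Q_meas [measurable]: "Measurable.pred H (\<lambda>z. z \<in> Q k i)" for k i
  proof -
    note [measurable] = infdist_meas
    have "Measurable.pred H (\<lambda>z. fst z \<in> R k i)" by measurable
    then show ?thesis unfolding Q_def mem_Collect_eq by measurable
  qed
  have infdist_antimono: "infdist y (E k') \<le> infdist y (E k)" if "k \<le> k'" for y k k'
    using that E_mono E_ne by (intro infdist_mono) auto
  have Q_disj: "k = k' \<and> i = i'" if "z \<in> Q k i" "z \<in> Q k' i'" for z k k' i i'
  proof -
    have False if "k < k'" "z \<in> Q k i" "z \<in> Q k' i'" for k k' i i'
      using that infdist_antimono[of "k + 1" k' "fst z"] by (auto simp: Q_def)
    then have "k = k'" using that by (metis linorder_neqE)
    moreover have "i = i'" if "k = k'"
    proof (rule ccontr)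
      assume "i \<noteq> i'"
      then have "R k i \<inter> R k i' = {}" using R_disj[of k] unfolding disjoint_family_on_def by blast
      then show False using \<open>z \<in> Q k i\<close> \<open>z \<in> Q k' i'\<close> that by (auto simp: Q_def)
    qed
    ultimately show ?thesis by simp
  qed
  have Q_close: "dist y (c k i) < r k i \<and> t \<le> 16 * r k i" if "(y, t) \<in> Q k i" for y t k i
    using that R_close[of y k i] by (auto simp: Q_def)
  \<comment> \<open>Empty cells get coefficient 0, as their balls are not accounted for in the Whitney sum.\<close>
  define l where "l k i = (if R k i = {} then 0 else 2 * A * 2 powr real_of_int k * s k i powr (1 / p))" for k i
  define a where "a k i z = (if R k i \<noteq> {} \<and> z \<in> Q k i then F z / complex_of_real (l k i) else 0)" for k i z
  have l_pos: "0 < l k i" if "R k i \<noteq> {}" for k i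
    using that M.C_ge_1 s(1)[of k i] by (simp add: l_def)
  have l_nonneg: "0 \<le> l k i" for k i
    using M.C_ge_1 by (simp add: l_def)
  have la: "complex_of_real (l k i) * a k i z = (if z \<in> Q k i then F z else 0)" for k i z
  proof (cases "R k i = {}")
    case False
    then show ?thesis using l_pos[OF False] by (simp add: a_def)
  qed (simp add: a_def Q_def)
  have a_meas [measurable]: "a k i \<in> borel_measurable H" for k i unfolding a_def by measurable
  have a_supp: "half_supp (a k i) \<subseteq> tent (B k i)" for k i
    unfolding B_def
    by (rule half_supp_subset_tent[OF ball_proper]) (use Q_close in \<open>auto simp: a_def split: if_splits\<close>)
  have a_zero: "sqfun M (a k i) x = 0" if "x \<notin> B k i" for k i x
  proof -
    have "ennreal ((cmod (a k i z))\<^sup>2) * cone_kernel M 1 x z = 0" for z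
    proof (cases "a k i z = 0 \<or> cone_kernel M 1 x z = 0")
      case False
      obtain y t where z: "z = (y, t)" by (cases z)
      have "dist x y < t" "(y, t) \<in> Q k i"
        using False by (auto simp: z a_def cone_kernel_def indicator_def split: if_splits)
      then have "dist (c k i) x < 32 * r k i"
        using Q_close[of y t k i] dist_triangle[of "c k i" x y] r_pos[of k i] by (simp add: dist_commute)
      then show ?thesis using that by (simp add: B_def)
    qed auto
    then have "cone_int M 1 (\<lambda>z. ennreal ((cmod (a k i z))\<^sup>2)) x = 0"
      unfolding cone_int_def by (simp only: nn_integral_const mult_zero_left)
    then show ?thesis by (simp add: sqfun_eq_cone_int)
  qed
  have a_bound: "sqfun M (a k i) x \<le> ennreal (s k i powr (- 1 / p))" for k i x
  proof (cases "R k i = {}")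
    case True
    then have "a k i = (\<lambda>z. 0)" by (auto simp: a_def)
    then show ?thesis by (simp add: sqfun_eq_cone_int cone_int_def)
  next
    case False
    define v where "v z = u z * indicator (Q k i) z" for z
    have v_meas: "v \<in> borel_measurable H" unfolding v_def by measurable
    have "cone_int M 1 v x \<le> ennreal (A\<^sup>2) * ennreal (4 powr real_of_int (k + 1))"
    proof (rule cone_int_le_of_level[OF u v_meas E_ne])
      show "v (y, t) = 0" if "t \<le> infdist y (E (k + 1))" for y t
        using that by (auto simp: v_def Q_def)
    qed (auto simp: E_def v_def indicator_def)
    then have *: "cone_int M 1 v x \<le> ennreal (A\<^sup>2 * 4 powr real_of_int (k + 1))"
      by (simp add: ennreal_mult)
    have "ennreal ((cmod (a k i z))\<^sup>2) = ennreal (1 / (l k i)\<^sup>2) * v z" for z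
    proof (cases "z \<in> Q k i")
      case True
      then have "(cmod (a k i z))\<^sup>2 = 1 / (l k i)\<^sup>2 * (cmod (F z))\<^sup>2"
        using l_nonneg False by (simp add: a_def norm_divide power_divide)
      then show ?thesis using True by (simp add: v_def u_def flip: ennreal_mult)
    qed (simp add: a_def v_def)
    then have "cone_int M 1 (\<lambda>z. ennreal ((cmod (a k i z))\<^sup>2)) x = ennreal (1 / (l k i)\<^sup>2) * cone_int M 1 v x"
      by (simp add: cone_int_cmult[OF v_meas])
    also have "\<dots> \<le> ennreal (1 / (l k i)\<^sup>2) * ennreal (A\<^sup>2 * 4 powr real_of_int (k + 1))"
      by (intro mult_left_mono *) simp
    also have "\<dots> = ennreal ((s k i powr (- 1 / p))\<^sup>2)"
    proof -
      define w where "w = s k i powr (1 / p)"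
      have "4 powr real_of_int (k + 1) = (2 * 2 powr real_of_int k)\<^sup>2"
      proof -
        have "4 powr real_of_int k = (2 powr 2) powr real_of_int k" by simp
        also have "\<dots> = (2 powr real_of_int k)\<^sup>2"
          unfolding powr_powr by (simp add: powr_realpow[symmetric] powr_powr mult.commute del: powr_realpow)
        finally show ?thesis by (simp add: powr_add power_mult_distrib)
      qed
      moreover have "s k i powr (- 1 / p) = 1 / w"
        unfolding w_def by (simp add: powr_minus divide_inverse)
      moreover have "l k i = 2 * A * 2 powr real_of_int k * w" using False by (simp add: l_def w_def)
      ultimately have "1 / (l k i)\<^sup>2 * (A\<^sup>2 * 4 powr real_of_int (k + 1)) = (s k i powr (- 1 / p))\<^sup>2"
        using M.C_ge_1 by (simp only: power_mult_distrib power_divide) (simp add: field_simps)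
      then show ?thesis by (simp flip: ennreal_mult)
    qed
    finally have "epowr (cone_int M 1 (\<lambda>z. ennreal ((cmod (a k i z))\<^sup>2)) x) (1 / 2) \<le> epowr (ennreal ((s k i powr (- 1 / p))\<^sup>2)) (1 / 2)"
      by (intro epowr_mono) auto
    also have "\<dots> = ennreal (s k i powr (- 1 / p))"
      using epowr_square_half[of "ennreal (s k i powr (- 1 / p))"] by (simp add: ennreal_power)
    finally show ?thesis by (simp add: sqfun_eq_cone_int)
  qed
  have a_atom: "epowr (\<integral>\<^sup>+x. epowr (sqfun M (a k i) x) q \<partial>W) (1 / q) \<le> epowr (emeasure W (B k i)) (1 / q - 1 / p)" for k i
    by (rule bounded_imp_Lq[OF _ s(2) s(1) q a_zero a_bound]) (simp_all add: B_def)
  have coeff_sum: "(\<integral>\<^sup>+k. \<integral>\<^sup>+i. ennreal (l k i powr p) \<partial>count_space UNIV \<partial>count_space UNIV)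
      \<le> ennreal (decomposition_const p) * I"
  proof -
    have lp: "ennreal (l k i powr p) = ennreal ((2 * A) powr p) * ennreal (4 powr (P * real_of_int k)) *
        (if R k i = {} then 0 else emeasure W (B k i))" for k i
    proof (cases "R k i = {}")
      case False
      have "(4::real) powr (P * real_of_int k) = (2 powr 2) powr (P * real_of_int k)" by simp
      also have "\<dots> = (2 powr real_of_int k) powr p"
        unfolding powr_powr by (simp add: P_def mult.commute)
      finally have "l k i powr p = (2 * A) powr p * 4 powr (P * real_of_int k) * s k i"
        using False M.C_ge_1 s(1)[of k i] p by (simp add: l_def powr_mult powr_powr)
      then show ?thesis using False s(1)[of k i] by (simp add: s(2) ennreal_mult)
    qed (use p in \<open>simp add: l_def\<close>)
    have "(\<integral>\<^sup>+k. \<integral>\<^sup>+i. ennreal (l k i powr p) \<partial>count_space UNIV \<partial>count_space UNIV)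
        \<le> (\<integral>\<^sup>+k. (ennreal ((2 * A) powr p) * ennreal (3 * C ^ 6)) * (ennreal (4 powr (P * real_of_int k)) * emeasure W (- E k)) \<partial>count_space UNIV)"
    proof (rule nn_integral_mono)
      fix k
      have "(\<integral>\<^sup>+i. ennreal (l k i powr p) \<partial>count_space UNIV)
          = ennreal ((2 * A) powr p) * ennreal (4 powr (P * real_of_int k)) *
             (\<integral>\<^sup>+i. (if R k i = {} then 0 else emeasure W (B k i)) \<partial>count_space UNIV)"
        unfolding lp by (rule nn_integral_cmult) simp
      also have "\<dots> \<le> ennreal ((2 * A) powr p) * ennreal (4 powr (P * real_of_int k)) *
          (ennreal (3 * C ^ 6) * emeasure W (- E k))"
        unfolding B_def by (intro mult_left_mono R_sum) simp
      finally show "(\<integral>\<^sup>+i. ennreal (l k i powr p) \<partial>count_space UNIV)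
          \<le> (ennreal ((2 * A) powr p) * ennreal (3 * C ^ 6)) * (ennreal (4 powr (P * real_of_int k)) * emeasure W (- E k))"
        by (simp only: mult_ac)
    qed
    also have "\<dots> = (ennreal ((2 * A) powr p) * ennreal (3 * C ^ 6)) *
        (\<integral>\<^sup>+k. ennreal (4 powr (P * real_of_int k)) * emeasure W (- E k) \<partial>count_space UNIV)"
      by (rule nn_integral_cmult) simp
    also have "\<dots> \<le> (ennreal ((2 * A) powr p) * ennreal (3 * C ^ 6)) * (ennreal (layer_const P) * I)"
      by (intro mult_left_mono layers) simp
    also have "\<dots> = ennreal (decomposition_const p) * I"
    proof -
      have "0 \<le> layer_const P"
        using aperture_const_bounds(3) P powr_less_mono[of "-P" 0 4] powr_less_mono[of "-(1-P)" 0 4]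
        unfolding layer_const_def by (intro mult_nonneg_nonneg add_nonneg_nonneg divide_nonneg_nonneg) auto
      then have "ennreal (decomposition_const p) = ennreal ((2 * A) powr p) * (ennreal (3 * C ^ 6) * ennreal (layer_const P))"
        unfolding decomposition_const_def P_def[symmetric] using W.C_ge_1
        by (subst ennreal_mult; simp)+
      then show ?thesis by (simp only: mult_ac)
    qed
    finally show ?thesis .
  qed
  have uncovered: "\<forall>k. infdist (fst z) (E k) < snd z" if z: "z \<in> space H" "\<And>k i. z \<notin> Q k i" for z
  proof (rule ccontr)
    obtain y t where yt: "z = (y, t)" "0 < t" using z(1) M.space_half_space by auto
    assume "\<not> ?thesis"
    then obtain k0 where k0: "t \<le> infdist y (E k0)" by (auto simp: yt not_less)
    obtain b where b: "0 < b" "emeasure W (ball y t) = ennreal b" using W.ball_real[OF yt(2)] .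
    obtain T where T: "0 \<le> T" "ennreal (layer_const P) * I = ennreal T"
      using total_fin by (cases "ennreal (layer_const P) * I") auto
    obtain n where n: "T / b < (4 powr P) ^ n"
      using real_arch_pow[of "4 powr P"] P powr_less_mono[of 0 P 4] by auto
    \<comment> \<open>Otherwise \<open>ball y t\<close> would be contained in \<open>O\<^sub>n\<close>, whose measure is too small for the chosen \<open>n\<close>.\<close>
    have large: "infdist y (E (int n)) < t"
    proof (rule ccontr)
      assume "\<not> ?thesis"
      then have "ball y t \<subseteq> - E (int n)"
        by (auto simp: not_less dest: infdist_le[of _ "E (int n)" y])
      then have "emeasure W (ball y t) \<le> emeasure W (- E (int n))" by (intro emeasure_mono) auto
      then have "ennreal (4 powr (P * real_of_int (int n))) * ennreal b
          \<le> ennreal (4 powr (P * real_of_int (int n))) * emeasure W (- E (int n))"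
        by (intro mult_left_mono) (simp_all add: b)
      also have "\<dots> \<le> ennreal T" using layer[of "int n"] T by simp
      finally have "4 powr (P * real n) * b \<le> T" using T b by (simp flip: ennreal_mult)
      moreover have "4 powr (P * real n) = (4 powr P) ^ n"
        by (simp add: powr_realpow[symmetric] powr_powr)
      ultimately show False using n b by (simp add: field_simps)
    qed
    \<comment> \<open>Descending from a level whose tent misses \<open>z\<close> to one whose tent contains \<open>z\<close> crosses a transition.\<close>
    have "k0 \<le> int n" using large k0 infdist_antimono[of "int n" k0 y] by linarith
    then have "t \<le> infdist y (E k0) \<longrightarrow> (\<exists>k. t \<le> infdist y (E k) \<and> infdist y (E (k + 1)) < t)"
      using large
    proof (induction k0 rule: int_le_induct)
      case (step k)
      then show ?case by (cases "t \<le> infdist y (E k)") (auto simp: not_le intro!: exI[of _ "k - 1"])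
    qed simp
    then obtain k where k: "t \<le> infdist y (E k)" "infdist y (E (k + 1)) < t" using k0 by blast
    then have "y \<in> (\<Union>i. R k i)" using R_union[of k] yt(2) by auto
    then obtain i where "y \<in> R k i" by auto
    then have "z \<in> Q k i" using k yt by (simp add: Q_def)
    then show False using z(2) by blast
  qed
  have vanish: "AE z in H. (\<forall>k i. z \<notin> Q k i) \<longrightarrow> F z = 0"
  proof -
    define Z where "Z = {z. \<forall>k. infdist (fst z) (E k) < snd z}"
    have Z_meas: "Measurable.pred H (\<lambda>z. z \<in> Z)"
      unfolding Z_def mem_Collect_eq using infdist_meas by measurable
    define v where "v z = (if z \<in> Z then u z else 0)" for z
    have v_meas [measurable]: "v \<in> borel_measurable H" unfolding v_def using Z_meas by measurable
    have "cone_int M 1 v x = 0" for x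
    proof (rule ccontr)
      assume "cone_int M 1 v x \<noteq> 0"
      have le: "cone_int M 1 v x \<le> ennreal (A\<^sup>2 * 4 powr real_of_int k)" for k
      proof -
        have "cone_int M 1 v x \<le> ennreal (A\<^sup>2) * ennreal (4 powr real_of_int k)"
        proof (rule cone_int_le_of_level[OF u v_meas E_ne])
          show "v (y, t) = 0" if "t \<le> infdist y (E k)" for y t
          proof -
            have "(y, t) \<notin> Z" using that by (auto simp: Z_def not_less intro!: exI[of _ k])
            then show ?thesis by (simp add: v_def)
          qed
        qed (auto simp: E_def v_def)
        then show ?thesis by (simp add: ennreal_mult)
      qed
      obtain e where e: "0 \<le> e" "cone_int M 1 v x = ennreal e"
        using le[of 0] by (cases "cone_int M 1 v x") (auto simp: top_unique)
      have "0 < e" using e \<open>cone_int M 1 v x \<noteq> 0\<close> by (auto simp: order_less_le)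
      then obtain n where n: "A\<^sup>2 / e < 4 ^ n" using real_arch_pow[of 4] by auto
      have "e \<le> A\<^sup>2 * 4 powr real_of_int (- int n)" using le[of "- int n"] e by simp
      also have "4 powr real_of_int (- int n) = 1 / 4 ^ n"
        by (simp add: powr_minus powr_realpow divide_inverse)
      finally show False using n \<open>0 < e\<close> by (simp add: field_simps)
    qed
    then have "AE z in H. v z = 0" by (intro cone_int_0_imp v_meas) simp
    moreover have "AE z in H. z \<in> space H" by simp
    ultimately show ?thesis
    proof eventually_elim
      fix z assume "v z = 0" "z \<in> space H"
      then show "(\<forall>k i. z \<notin> Q k i) \<longrightarrow> F z = 0"
        using uncovered[of z] by (auto simp: v_def Z_def u_def)
    qed
  qed
  obtain e :: "nat \<Rightarrow> int \<times> (int \<times> nat)" where e: "bij e"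
  proof -
    have "infinite (UNIV :: (int \<times> (int \<times> nat)) set)" by (simp add: finite_prod)
    then show thesis using that bij_betw_from_nat_into[of "UNIV :: (int \<times> (int \<times> nat)) set"] by auto
  qed
  define lam where "lam j = complex_of_real (l (fst (e j)) (snd (e j)))" for j
  define b where "b j = a (fst (e j)) (snd (e j))" for j
  have "(\<lambda>j. lam j * b j z) sums F z" if z: "(\<forall>k i. z \<notin> Q k i) \<longrightarrow> F z = 0" for z
  proof (cases "\<exists>k i. z \<in> Q k i")
    case True
    then obtain k i where ki: "z \<in> Q k i" by blast
    define j0 where "j0 = inv e (k, i)"
    have j0: "e j0 = (k, i)" using e unfolding j0_def by (simp add: bij_is_surj surj_f_inv_f)
    have "lam j * b j z = (if j = j0 then F z else 0)" for j
    proof (cases "j = j0")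
      case False
      then have "e j \<noteq> (k, i)" using j0 e by (metis bij_pointE)
      then have "z \<notin> Q (fst (e j)) (snd (e j))" using Q_disj[OF ki] by (metis prod.collapse)
      then show ?thesis using False by (simp add: lam_def b_def la)
    qed (simp add: lam_def b_def la j0 ki)
    then show ?thesis using sums_single[of j0 "\<lambda>_. F z"] by simp
  next
    case False
    then have "z \<notin> Q (fst (e j)) (snd (e j))" for j by blast
    then have zero: "(\<lambda>j. lam j * b j z) = (\<lambda>_. 0)" by (simp add: lam_def b_def la fun_eq_iff)
    have "F z = 0" using z False by blast
    then show ?thesis unfolding zero by simp
  qed
  then have "AE z in H. (\<lambda>j. lam j * b j z) sums F z" by (rule eventually_mono[OF vanish])
  moreover have "(\<Sum>j. ennreal (cmod (lam j) powr p)) \<le> ennreal (decomposition_const p) * I"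
  proof -
    let ?g = "\<lambda>x. ennreal (l (fst x) (snd x) powr p)"
    have "(\<Sum>j. ennreal (cmod (lam j) powr p)) = (\<integral>\<^sup>+j. ?g (e j) \<partial>count_space UNIV)"
      using l_nonneg by (simp add: lam_def nn_integral_count_space_nat)
    also have "\<dots> = (\<integral>\<^sup>+x. ?g x \<partial>count_space UNIV)"
      using e by (rule nn_integral_bij_count_space)
    also have "\<dots> = (\<integral>\<^sup>+k. \<integral>\<^sup>+i. ?g (k, i) \<partial>count_space UNIV \<partial>count_space UNIV)"
      by (rule nn_integral_fst_count_space[symmetric])
    finally show ?thesis using coeff_sum by simp
  qed
  moreover have "b j \<in> borel_measurable H \<and>
        (\<exists>c \<rho>. \<rho> > 0 \<and> half_supp (b j) \<subseteq> tent (ball c \<rho>) \<and>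
           epowr (\<integral>\<^sup>+x. epowr (sqfun M (b j) x) q \<partial>W) (1 / q) \<le> epowr (emeasure W (ball c \<rho>)) (1 / q - 1 / p))" for j
    unfolding b_def using a_supp a_atom a_meas r_pos unfolding B_def
    by (metis mult_pos_pos zero_less_numeral)
  ultimately show ?thesis unfolding I by blast
qed

end

section \<open>The theorem\<close>

theorem theorem1p8:
  fixes M :: "'a::metric_space measure" and w :: "'a \<Rightarrow> real" and p q :: real
  assumes "doubling_measure M"
    and "emeasure M (space M) = \<infinity>"
    and "\<And>x. emeasure M {x} = 0"
    and "0 < p" "p \<le> 1"
    and "1 < q"
    and "w \<in> Muckenhoupt_inf M"
  shows
    "(\<exists>C::real. C > 0 \<and>
        (\<forall>F \<in> tent_space M w p.
           \<exists>(lam :: nat \<Rightarrow> complex) (a :: nat \<Rightarrow> 'a \<times> real \<Rightarrow> complex).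
             (\<forall>j. tent_atom M w p q (a j)) \<and>
             (AE z in half_space M. (\<lambda>j. lam j * a j z) sums F z) \<and>
             lp_norm p lam \<le> ennreal C * tent_norm M w p F))
     \<and>
     (\<forall>(lam :: nat \<Rightarrow> complex) (a :: nat \<Rightarrow> 'a \<times> real \<Rightarrow> complex).
        lp_norm p lam < \<infinity> \<and> (\<forall>j. tent_atom M w p q (a j)) \<longrightarrow>
        (let F = (\<lambda>z. \<Sum>j. lam j * a j z) in
           (AE z in half_space M. (\<lambda>j. lam j * a j z) sums F z) \<and>
           F \<in> tent_space M w p \<and>
           tent_norm M w p F \<le> lp_norm p lam))"
proof -
  note p = assms(4,5) and q = assms(6)
  obtain A where A: "doubling M A" using doubling_of_doubling_measure[OF assms(1,2)] by blast
  obtain r where r: "1 < r" "w \<in> Muckenhoupt M r" using assms(7) by (auto simp: Muckenhoupt_inf_def)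
  define W where "W = density M (\<lambda>x. ennreal (w x))"
  obtain C where C: "doubling W C" using doubling_density[OF A r] unfolding W_def by blast
  interpret doubling_pair M W A C
    using A C by (simp add: doubling_pair_def)
  have w_meas [measurable]: "w \<in> borel_measurable M" using r by (simp add: Muckenhoupt_def weight_def)
  have unb: "ball x \<rho> \<noteq> UNIV" for x :: 'a and \<rho>
    using M.finite_ball[of x \<rho>] assms(2) by auto
  have W_inf: "emeasure W UNIV = \<infinity>" by (rule W.infinite_if_unbounded[OF unb])
  have Lnorm_W: "Lnorm M w s f = epowr (\<integral>\<^sup>+x. epowr (f x) s \<partial>W) (1 / s)" if "f \<in> borel_measurable borel" for s f
  proof -
    have "(\<lambda>x. epowr (f x) s) \<in> borel_measurable M"
      using epowr_measurable[OF that] by (simp add: measurable_cong_sets[OF M.sets_N refl])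
    then show ?thesis by (simp add: Lnorm_def W_def nn_integral_density mult.commute)
  qed
  have sq_meas: "sqfun M G \<in> borel_measurable borel" if [measurable]: "G \<in> borel_measurable H" for G
    unfolding sqfun_eq_cone_int[abs_def] by (intro epowr_measurable M.cone_int_measurable) measurable
  have tent_norm_W: "tent_norm M w s G = epowr (\<integral>\<^sup>+x. epowr (sqfun M G x) s \<partial>W) (1 / s)"
    if "G \<in> borel_measurable H" for s G
    unfolding tent_norm_def by (rule Lnorm_W[OF sq_meas[OF that]])
  have tent_space_iff: "G \<in> tent_space M w p \<longleftrightarrow>
      G \<in> borel_measurable H \<and> (\<integral>\<^sup>+x. epowr (sqfun M G x) p \<partial>W) < \<infinity>" for G
    using p sq_meas[of G] by (auto simp: tent_space_def Lspace_def Lnorm_W epowr_less_top_iff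
        measurable_cong_sets[OF M.sets_N refl])
  have wmeasure_W: "wmeasure M w (ball c \<rho>) = emeasure W (ball c \<rho>)" for c \<rho>
    unfolding wmeasure_def W_def by (rule emeasure_density[symmetric]) auto
  have tent_atom_iff: "tent_atom M w p q a \<longleftrightarrow> a \<in> borel_measurable H \<and>
        (\<exists>c \<rho>. \<rho> > 0 \<and> half_supp a \<subseteq> tent (ball c \<rho>) \<and>
           epowr (\<integral>\<^sup>+x. epowr (sqfun M a x) q \<partial>W) (1 / q) \<le> epowr (emeasure W (ball c \<rho>)) (1 / q - 1 / p))" for a
    unfolding tent_atom_def wmeasure_W
    by (cases "a \<in> borel_measurable H") (simp_all only: tent_norm_W simp_thms)
  \<comment> \<open>The summand 1 only makes the constant positive.\<close>
  define D where "D = decomposition_const p powr (1 / p) + 1"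
  have D_pos: "D > 0" by (simp add: D_def add_nonneg_pos)
  have part1: "\<exists>lam a. (\<forall>j. tent_atom M w p q (a j)) \<and>
             (AE z in half_space M. (\<lambda>j. lam j * a j z) sums F z) \<and>
             lp_norm p lam \<le> ennreal D * tent_norm M w p F" if F: "F \<in> tent_space M w p" for F
  proof -
    have F_meas: "F \<in> borel_measurable H" and fin: "(\<integral>\<^sup>+x. epowr (sqfun M F x) p \<partial>W) < \<infinity>"
      using F by (auto simp: tent_space_iff)
    have "\<exists>lam a. (\<forall>j. tent_atom M w p q (a j)) \<and> (AE z in H. (\<lambda>j. lam j * a j z) sums F z) \<and>
        (\<Sum>j. ennreal (cmod (lam j) powr p))
          \<le> ennreal (decomposition_const p) * (\<integral>\<^sup>+x. epowr (sqfun M F x) p \<partial>W)"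
      unfolding tent_atom_iff using q by (intro decomposition W_inf F_meas p fin) simp
    then obtain lam a where atoms: "\<And>j. tent_atom M w p q (a j)"
      and sums: "AE z in H. (\<lambda>j. lam j * a j z) sums F z"
      and bound: "(\<Sum>j. ennreal (cmod (lam j) powr p))
          \<le> ennreal (decomposition_const p) * (\<integral>\<^sup>+x. epowr (sqfun M F x) p \<partial>W)"
      by blast
    have "lp_norm p lam \<le> epowr (ennreal (decomposition_const p) * (\<integral>\<^sup>+x. epowr (sqfun M F x) p \<partial>W)) (1 / p)"
      unfolding lp_norm_def using p by (intro epowr_mono bound) auto
    also have "\<dots> = epowr (ennreal (decomposition_const p)) (1 / p) * tent_norm M w p F"
      using p by (simp add: epowr_mult tent_norm_W[OF F_meas])
    also have "\<dots> \<le> ennreal D * tent_norm M w p F"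
    proof (rule mult_right_mono)
      show "epowr (ennreal (decomposition_const p)) (1 / p) \<le> ennreal D"
        using p by (cases "0 \<le> decomposition_const p") (auto simp: D_def epowr_ennreal ennreal_neg intro!: ennreal_leI)
    qed simp
    finally show ?thesis using atoms sums by blast
  qed
  have part2: "(AE z in H. (\<lambda>j. lam j * a j z) sums (\<Sum>j. lam j * a j z)) \<and>
           (\<lambda>z. \<Sum>j. lam j * a j z) \<in> tent_space M w p \<and>
           tent_norm M w p (\<lambda>z. \<Sum>j. lam j * a j z) \<le> lp_norm p lam"
    if lam: "lp_norm p lam < \<infinity>" and atoms: "\<And>j. tent_atom M w p q (a j)" for lam a
  proof -
    have a_meas [measurable]: "a j \<in> borel_measurable H" for j using atoms by (simp add: tent_atom_iff)
    have norm1: "(\<integral>\<^sup>+x. epowr (sqfun M (a j) x) p \<partial>W) \<le> 1" for j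
    proof -
      obtain c \<rho> where \<rho>: "\<rho> > 0" and supp: "half_supp (a j) \<subseteq> tent (ball c \<rho>)"
        and size: "epowr (\<integral>\<^sup>+x. epowr (sqfun M (a j) x) q \<partial>W) (1 / q) \<le> epowr (emeasure W (ball c \<rho>)) (1 / q - 1 / p)"
        using atoms[of j] by (auto simp: tent_atom_iff)
      obtain s where s: "0 < s" "emeasure W (ball c \<rho>) = ennreal s" using W.ball_real[OF \<rho>] .
      show ?thesis
      proof (rule atom_Lp_le_1[OF _ s(2,1) p(1) _ sq_meas[OF a_meas] _ size])
        show "sqfun M (a j) x = 0" if x: "x \<notin> ball c \<rho>" for x
        proof -
          have "ennreal ((cmod (a j z))\<^sup>2) * cone_kernel M 1 x z = 0" if z: "z \<in> space H" for z
          proof (cases "a j z = 0 \<or> cone_kernel M 1 x z = 0")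
            case False
            obtain y t where yt: "z = (y, t)" "0 < t" using z M.space_half_space by auto
            have "dist x y < t" using False by (auto simp: yt cone_kernel_def indicator_def split: if_splits)
            have "z \<in> {z \<in> UNIV \<times> {0<..}. a j z \<noteq> 0}" using False yt by simp
            then have "z \<in> half_supp (a j)"
              unfolding half_supp_def using yt by (auto intro: closure_subset[THEN subsetD])
            then have "t \<le> infdist y (- ball c \<rho>)" using supp by (auto simp: yt tent_def)
            also have "\<dots> \<le> dist y x" using x by (intro infdist_le) simp
            finally show ?thesis using \<open>dist x y < t\<close> by (simp add: dist_commute)
          qed auto
          then have "cone_int M 1 (\<lambda>z. ennreal ((cmod (a j z))\<^sup>2)) x = (\<integral>\<^sup>+z. 0 \<partial>H)"
            unfolding cone_int_def by (rule nn_integral_cong)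
          then show ?thesis by (simp add: sqfun_eq_cone_int)
        qed
      qed (use p q in auto)
    qed
    have lam': "(\<Sum>j. ennreal (cmod (lam j) powr p)) < \<infinity>"
      using lam p by (simp add: lp_norm_def epowr_less_top_iff)
    note syn = synthesis[OF a_meas norm1 p lam']
    have F_meas: "(\<lambda>z. \<Sum>j. lam j * a j z) \<in> borel_measurable H" by measurable
    show ?thesis
    proof (intro conjI)
      show "(\<lambda>z. \<Sum>j. lam j * a j z) \<in> tent_space M w p"
        unfolding tent_space_iff by (intro conjI F_meas order_le_less_trans[OF syn(2) lam'])
      show "tent_norm M w p (\<lambda>z. \<Sum>j. lam j * a j z) \<le> lp_norm p lam"
        unfolding tent_norm_W[OF F_meas] lp_norm_def using p by (intro epowr_mono syn(2)) simp
    qed (rule syn(1))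
  qed
  show ?thesis
    by (rule conjI, rule exI[of _ D], rule conjI[OF D_pos], rule ballI, erule part1,
        unfold Let_def, (rule allI)+, rule impI, erule conjE, rule part2, assumption, erule spec)
qed

end
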